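(* For $1\le i<j\le 2n$ let $c_{ij}=\sum_{k<l}\xi^{ij}_{kl}\otimes b_{kl}\in\mathscr{F}_R(M(2n))\widetilde\otimes\mathcal B$, where $\xi^{ij}_{kl}$ are the $2\times2$ dynamical quantum minors of $\mathscr{F}_R(M(2n))$ and $b_{kl}$ are the generators of $\mathcal B$, and let $C=(c_{ij})$. Then in $\mathscr{F}_R(M(2n))\widetilde\otimes\mathcal B$ $$\mathrm{Pf}(C)=\det(T)\otimes\mathrm{Pf}(B).$$
   Context: Notation: put $N=2n$, $[1,N]=\{1,\ldots,N\}$; $q\in\mathbb C^\times$ is generic; $\mathfrak h^*\cong\mathbb C^{N}$ with basis $e_1,\ldots,e_N$, $\omega(i)=e_i$; $M_{\mathfrak h^*}$ is the algebra of meromorphic functions $f(\underline\lambda)=f(\lambda_1,\ldots,\lambda_N)$ on $\mathfrak h^*$. Set $h(\lambda)=q\dfrac{q^{-2\lambda}-q^{-2}}{q^{-2\lambda}-1}$, $g(\lambda)=h(\lambda)h(-\lambda)$. $\mathscr{F}_R(M(N))$ is the associative algebra generated by $t_{ij}$ ($1\le i,j\le N$) and two copies of $M_{\mathfrak h^*}$ embedded as subalgebras, with elements $f(\underline\lambda)=\mu_l(f)$ and $f(\underline\mu)=\mu_r(f)$, subject to: $f_1(\underline\lambda)f_2(\underline\mu)=f_2(\underline\mu)f_1(\underline\lambda)$, $f(\underline\lambda)t_{ij}=t_{ij}f(\underline\lambda+\omega(i))$, $f(\underline\mu)t_{ij}=t_{ij}f(\underline\mu+\omega(j))$, and - $h(\mu_k-\mu_l)t_{ik}t_{il}=t_{il}t_{ik}$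 for $k<l$; - $h(\lambda_j-\lambda_i)t_{jk}t_{ik}=t_{ik}t_{jk}$ for $i<j$; - $t_{ik}t_{jl}=t_{jl}t_{ik}+(h(\lambda_j-\lambda_i)-h(\mu_k-\mu_l))t_{jk}t_{il}$ for $i<j$, $k<l$; - $g(\mu_k-\mu_l)t_{ik}t_{jl}=g(\lambda_i-\lambda_j)t_{jl}t_{ik}+(h(\mu_l-\mu_k)-h(\lambda_i-\lambda_j))t_{il}t_{jk}$ for $i<j$, $k<l$. For $I=\{i_1<\cdots<i_r\}\subset[1,N]$ and $\sigma\in S_r$, $S(\sigma,I)(\underline\lambda)=\prod_{k<l,\ \sigma(k)>\sigma(l)}(-h(\lambda_{i_{\sigma(k)}}-\lambda_{i_{\sigma(l)}}))$. For $J=\{j_1<\cdots<j_r\}$ the dynamical quantum minor is $\xi^I_J=\mu_r(S(\rho,J)^{-1})\sum_{\sigma\in S_r}\mu_l(S(\sigma,I))\,t_{i_{\sigma(1)}j_{\rho(1)}}\cdots t_{i_{\sigma(r)}j_{\rho(r)}}$, which is independent of $\rho\in S_r$ (one may take $\rho=\mathrm{id}$). Write $\xi^{ij}_{kl}=\xi^{\{i,j\}}_{\{k,l\}}$ for $i<j$, $k<l$, and $\det(T)=\xi^{[1,N]}_{[1,N]}$, where $T=(t_{ij})$. $\mathcal B$ is the algebra generated by $b_{ij}$, $1\le i<j\le 2n$, and a copy of $M_{\mathfrak h^*}$ embedded as a subalgebra, its elements denoted by $f(\underline\lambda)$ (no further relations are specified). $\mathscr{F}_R(M(2n))\widetilde\otimes\mathcal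 B$ denotes the usual tensor product (with factorwise products) modulo the relations $\mu_r(f)t\otimes b=t\otimes fb$ and $f(t\otimes b)=\mu_l(f)t\otimes b$ for $f\in M_{\mathfrak h^*}$; the second describes how $f$ acts on the left. For $X=(x_{ij})_{1\le i<j\le 2n}$ (here $X=B=(b_{ij})$ in $\mathcal B$, or $X=C$ in $\mathscr{F}_R(M(2n))\widetilde\otimes\mathcal B$), the dynamical quantum Pfaffian is $$\mathrm{Pf}(X)=\sum_{\sigma}S(\sigma,[1,2n])\,x_{\sigma(1)\sigma(2)}x_{\sigma(3)\sigma(4)}\cdots x_{\sigma(2n-1)\sigma(2n)},$$ the sum over all $\sigma\in S_{2n}$ with $\sigma(2k-1)<\sigma(2k)$ for $k=1,\ldots,n$ (the order of the pairs is not restricted).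
   Formalization: F_R(M(N)) also gets, for i<j, k<l, g(μ_k-μ_l)t_jk t_il = t_il t_jk + (h(μ_l-μ_k)-h(λ_j-λ_i))t_jl t_ik (2×2 minors independent of ρ), without which the claim fails for n=2; products of c_ij are formed before imposing μ_r(f)t⊗b = t⊗fb, as they do not descend. *)

theory Defs
  imports
    "HOL-Complex_Analysis.Conformal_Mappings"
    "HOL-Algebra.QuotRing"
    "HOL-Algebra.Generated_Groups"
    "HOL-Algebra.Module"
    "HOL-Library.Poly_Mapping"
begin

section \<open>Meromorphic functions of several variables\<close>

definition holo_on :: "(complex^'n \<Rightarrow> complex) \<Rightarrow> (complex^'n) set \<Rightarrow> bool" where
  "holo_on f U \<longleftrightarrow>
     (\<forall>z\<in>U. \<exists>D. (f has_derivative D) (at z) \<and> (\<forall>c v. D (c *s v) = c * D v))"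

definition nondegenerate_on :: "(complex^'n \<Rightarrow> complex) \<Rightarrow> (complex^'n) set \<Rightarrow> bool" where
  "nondegenerate_on k U \<longleftrightarrow> (\<forall>V. open V \<and> V \<subseteq> U \<and> V \<noteq> {} \<longrightarrow> (\<exists>w\<in>V. k w \<noteq> 0))"

text \<open>
  Meromorphic functions are represented by total functions that are locally quotients of
  holomorphic functions wherever the denominator does not vanish; the values on the zero sets of
  the denominators are arbitrary. Two representatives are identified if they agree on a dense open
  set.
\<close>

definition merom :: "(complex^'n \<Rightarrow> complex) \<Rightarrow> bool" where
  "merom f \<longleftrightarrow>
     (\<forall>z. \<exists>U g k. open U \<and> z \<in> U \<and> holo_on g U \<and> holo_on k U \<and> nondegenerate_on k U \<and>
        (\<forall>w\<in>U. k w \<noteq> 0 \<longrightarrow> f w = g w / k w))"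

definition merom_eq :: "(complex^'n \<Rightarrow> complex) \<Rightarrow> (complex^'n \<Rightarrow> complex) \<Rightarrow> bool" where
  "merom_eq f f' \<longleftrightarrow> merom f \<and> merom f' \<and>
     (\<exists>W. open W \<and> closure W = UNIV \<and> (\<forall>w\<in>W. f w = f' w))"

lemma holo_on_subset: "holo_on f U \<Longrightarrow> V \<subseteq> U \<Longrightarrow> holo_on f V"
  by (auto simp: holo_on_def)

lemma nondegenerate_on_subset: "nondegenerate_on f U \<Longrightarrow> V \<subseteq> U \<Longrightarrow> nondegenerate_on f V"
  by (auto simp: nondegenerate_on_def)

lemma holo_on_imp_continuous_on: "holo_on f U \<Longrightarrow> continuous_on U f"
  by (meson continuous_at_imp_continuous_on has_derivative_continuous holo_on_def)

lemma holo_on_const: "holo_on (\<lambda>_. c) U"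
  unfolding holo_on_def by (auto intro!: exI[of _ "\<lambda>_. 0"])

lemma holo_on_add: "holo_on f U \<Longrightarrow> holo_on g U \<Longrightarrow> holo_on (\<lambda>z. f z + g z) U"
  unfolding holo_on_def
proof safe
  fix z assume "\<forall>z\<in>U. \<exists>D. (f has_derivative D) (at z) \<and> (\<forall>c v. D (c *s v) = c * D v)"
    "\<forall>z\<in>U. \<exists>D. (g has_derivative D) (at z) \<and> (\<forall>c v. D (c *s v) = c * D v)" "z \<in> U"
  then obtain D E where "(f has_derivative D) (at z)" "\<forall>c v. D (c *s v) = c * D v"
    "(g has_derivative E) (at z)" "\<forall>c v. E (c *s v) = c * E v" by blast
  then show "\<exists>D. ((\<lambda>z. f z + g z) has_derivative D) (at z) \<and> (\<forall>c v. D (c *s v) = c * D v)"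
    by (intro exI[of _ "\<lambda>v. D v + E v"]) (auto intro!: derivative_eq_intros simp: algebra_simps)
qed

lemma holo_on_mult: "holo_on f U \<Longrightarrow> holo_on g U \<Longrightarrow> holo_on (\<lambda>z. f z * g z) U"
  unfolding holo_on_def
proof safe
  fix z assume "\<forall>z\<in>U. \<exists>D. (f has_derivative D) (at z) \<and> (\<forall>c v. D (c *s v) = c * D v)"
    "\<forall>z\<in>U. \<exists>D. (g has_derivative D) (at z) \<and> (\<forall>c v. D (c *s v) = c * D v)" "z \<in> U"
  then obtain D E where "(f has_derivative D) (at z)" "\<forall>c v. D (c *s v) = c * D v"
    "(g has_derivative E) (at z)" "\<forall>c v. E (c *s v) = c * E v" by blast
  then show "\<exists>D. ((\<lambda>z. f z * g z) has_derivative D) (at z) \<and> (\<forall>c v. D (c *s v) = c * D v)"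
    by (intro exI[of _ "\<lambda>v. f z * E v + D v * g z"])
       (auto intro!: derivative_eq_intros simp: algebra_simps)
qed

lemma holo_on_uminus: "holo_on f U \<Longrightarrow> holo_on (\<lambda>z. - f z) U"
  using holo_on_mult[OF holo_on_const[of "-1"], of f U] by simp

lemma open_nonzero:
  assumes "open U" "holo_on k U"
  shows "open {w\<in>U. k w \<noteq> 0}"
proof -
  have "open (U \<inter> k -` (- {0}))"
    using assms by (intro continuous_open_preimage holo_on_imp_continuous_on) auto
  moreover have "U \<inter> k -` (- {0}) = {w\<in>U. k w \<noteq> 0}" by auto
  ultimately show ?thesis by simp
qed

lemma nondegenerate_on_mult:
  assumes "open U" "holo_on k U" "nondegenerate_on k U" "nondegenerate_on l U"
  shows "nondegenerate_on (\<lambda>z. k z * l z) U"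
  unfolding nondegenerate_on_def
proof (intro allI impI, elim conjE)
  fix V assume V: "open V" "V \<subseteq> U" "V \<noteq> {}"
  then obtain w where "w \<in> V" "k w \<noteq> 0" using assms(3) by (auto simp: nondegenerate_on_def)
  then have ne: "{w\<in>V. k w \<noteq> 0} \<noteq> {}" "{w\<in>V. k w \<noteq> 0} \<subseteq> U" using V by auto
  have op: "open {w\<in>V. k w \<noteq> 0}"
    using open_nonzero[OF V(1) holo_on_subset[OF assms(2) V(2)]] .
  obtain w' where "w' \<in> {w\<in>V. k w \<noteq> 0}" "l w' \<noteq> 0"
    using assms(4) op ne unfolding nondegenerate_on_def by metis
  then show "\<exists>w\<in>V. k w * l w \<noteq> 0" by (intro bexI[of _ w']) auto
qed

lemma meromE:
  assumes "merom f"
  obtains e g k where "e > 0" "holo_on g (ball z e)" "holo_on k (ball z e)"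
    "nondegenerate_on k (ball z e)" "\<And>w. w \<in> ball z e \<Longrightarrow> k w \<noteq> 0 \<Longrightarrow> f w = g w / k w"
proof -
  obtain U g k where U: "open U" "z \<in> U" "holo_on g U" "holo_on k U" "nondegenerate_on k U"
        "\<forall>w\<in>U. k w \<noteq> 0 \<longrightarrow> f w = g w / k w"
    using assms unfolding merom_def by blast
  obtain e where "e > 0" "ball z e \<subseteq> U" using U(1,2) open_contains_ball_eq by blast
  show ?thesis
  proof (rule that[of e g k])
    show "e > 0" "holo_on g (ball z e)" "holo_on k (ball z e)" "nondegenerate_on k (ball z e)"
      using \<open>e > 0\<close> \<open>ball z e \<subseteq> U\<close> U(3-5) holo_on_subset nondegenerate_on_subset by blast+
    show "f w = g w / k w" if "w \<in> ball z e" "k w \<noteq> 0" for w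
      using that \<open>ball z e \<subseteq> U\<close> U(6) by blast
  qed
qed

lemma meromE2:
  assumes "merom f1" "merom f2"
  obtains U g1 k1 g2 k2 where "open U" "z \<in> U" "holo_on g1 U" "holo_on k1 U"
    "holo_on g2 U" "holo_on k2 U" "nondegenerate_on k1 U" "nondegenerate_on k2 U"
    "\<And>w. w \<in> U \<Longrightarrow> k1 w \<noteq> 0 \<Longrightarrow> f1 w = g1 w / k1 w" "\<And>w. w \<in> U \<Longrightarrow> k2 w \<noteq> 0 \<Longrightarrow> f2 w = g2 w / k2 w"
proof -
  obtain e1 g1 k1 where 1: "e1 > 0" "holo_on g1 (ball z e1)" "holo_on k1 (ball z e1)"
    "nondegenerate_on k1 (ball z e1)" "\<And>w. w \<in> ball z e1 \<Longrightarrow> k1 w \<noteq> 0 \<Longrightarrow> f1 w = g1 w / k1 w"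
    using meromE[OF assms(1), of z] by blast
  obtain e2 g2 k2 where 2: "e2 > 0" "holo_on g2 (ball z e2)" "holo_on k2 (ball z e2)"
    "nondegenerate_on k2 (ball z e2)" "\<And>w. w \<in> ball z e2 \<Longrightarrow> k2 w \<noteq> 0 \<Longrightarrow> f2 w = g2 w / k2 w"
    using meromE[OF assms(2), of z] by blast
  have "ball z (min e1 e2) \<subseteq> ball z e1" "ball z (min e1 e2) \<subseteq> ball z e2" by auto
  then show ?thesis
    using 1 2
    by (intro that[of "ball z (min e1 e2)" g1 k1 g2 k2])
       (auto intro: holo_on_subset nondegenerate_on_subset)
qed

lemma merom_holo: "holo_on f UNIV \<Longrightarrow> merom f"
  unfolding merom_def
  by (intro allI exI[of _ UNIV] exI[of _ f] exI[of _ "\<lambda>_. 1"])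
     (auto simp: holo_on_const nondegenerate_on_def)

lemma merom_const: "merom (\<lambda>_. c)"
  by (intro merom_holo holo_on_const)

lemma merom_add:
  assumes "merom f1" "merom f2"
  shows "merom (\<lambda>z. f1 z + f2 z)"
  unfolding merom_def
proof
  fix z
  from meromE2[OF assms, of z] obtain U g1 k1 g2 k2 where U: "open U" "z \<in> U" "holo_on g1 U"
    "holo_on k1 U" "holo_on g2 U" "holo_on k2 U" "nondegenerate_on k1 U" "nondegenerate_on k2 U"
    "\<And>w. w \<in> U \<Longrightarrow> k1 w \<noteq> 0 \<Longrightarrow> f1 w = g1 w / k1 w" "\<And>w. w \<in> U \<Longrightarrow> k2 w \<noteq> 0 \<Longrightarrow> f2 w = g2 w / k2 w"
    by metis
  show "\<exists>U g k. open U \<and> z \<in> U \<and> holo_on g U \<and> holo_on k U \<and> nondegenerate_on k U \<and>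
        (\<forall>w\<in>U. k w \<noteq> 0 \<longrightarrow> f1 w + f2 w = g w / k w)"
    using U
    by (intro exI[of _ U] exI[of _ "\<lambda>w. g1 w * k2 w + g2 w * k1 w"] exI[of _ "\<lambda>w. k1 w * k2 w"])
       (auto intro!: holo_on_add holo_on_mult nondegenerate_on_mult simp: field_simps)
qed

lemma merom_mult:
  assumes "merom f1" "merom f2"
  shows "merom (\<lambda>z. f1 z * f2 z)"
  unfolding merom_def
proof
  fix z
  from meromE2[OF assms, of z] obtain U g1 k1 g2 k2 where U: "open U" "z \<in> U" "holo_on g1 U"
    "holo_on k1 U" "holo_on g2 U" "holo_on k2 U" "nondegenerate_on k1 U" "nondegenerate_on k2 U"
    "\<And>w. w \<in> U \<Longrightarrow> k1 w \<noteq> 0 \<Longrightarrow> f1 w = g1 w / k1 w" "\<And>w. w \<in> U \<Longrightarrow> k2 w \<noteq> 0 \<Longrightarrow> f2 w = g2 w / k2 w"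
    by metis
  show "\<exists>U g k. open U \<and> z \<in> U \<and> holo_on g U \<and> holo_on k U \<and> nondegenerate_on k U \<and>
        (\<forall>w\<in>U. k w \<noteq> 0 \<longrightarrow> f1 w * f2 w = g w / k w)"
    using U
    by (intro exI[of _ U] exI[of _ "\<lambda>w. g1 w * g2 w"] exI[of _ "\<lambda>w. k1 w * k2 w"])
       (auto intro!: holo_on_mult nondegenerate_on_mult simp: field_simps)
qed

lemma merom_uminus: "merom f \<Longrightarrow> merom (\<lambda>z. - f z)"
  using merom_mult[OF merom_const[of "-1"], of f] by simp

lemma identity_ball:
  fixes g :: "complex^'n \<Rightarrow> complex"
  assumes g: "holo_on g (ball z e)" and ng: "\<not> nondegenerate_on g (ball z e)" and w: "w \<in> ball z e"
  shows "g w = 0"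
proof -
  obtain V where V: "open V" "V \<subseteq> ball z e" "V \<noteq> {}" "\<And>w. w \<in> V \<Longrightarrow> g w = 0"
    using ng by (auto simp: nondegenerate_on_def)
  obtain a where a: "a \<in> V" using V by auto
  define \<gamma> where "\<gamma> = (\<lambda>\<zeta>::complex. a + \<zeta> *s (w - a))"
  have lin: "bounded_linear (\<lambda>\<zeta>::complex. \<zeta> *s (w - a))"
    unfolding linear_conv_bounded_linear[symmetric]
    by (rule linearI) (simp_all add: vec_eq_iff algebra_simps)
  have \<gamma>: "(\<gamma> has_derivative (\<lambda>\<zeta>. \<zeta> *s (w - a))) (at \<zeta>)" for \<zeta>
    unfolding \<gamma>_def
    using has_derivative_add[OF has_derivative_const bounded_linear_imp_has_derivative[OF lin]]
    by simp
  have cont: "continuous_on UNIV \<gamma>"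
    by (intro continuous_at_imp_continuous_on ballI has_derivative_continuous[OF \<gamma>])
  define S where "S = \<gamma> -` ball z e"
  define T where "T = \<gamma> -` V"
  have "open S" "open T"
    unfolding S_def T_def by (rule open_vimage[OF _ cont], use V(1) in simp)+
  have "convex S"
  proof (rule convexI)
    fix x y u v assume "x \<in> S" "y \<in> S" and uv: "(0::real) \<le> u" "0 \<le> v" "u + v = 1"
    then have "\<gamma> x \<in> ball z e" "\<gamma> y \<in> ball z e" unfolding S_def by blast+
    then have "u *\<^sub>R \<gamma> x + v *\<^sub>R \<gamma> y \<in> ball z e"
      using uv by (rule convexD[OF convex_ball])
    moreover have "u *\<^sub>R \<gamma> x + v *\<^sub>R \<gamma> y = (u + v) *\<^sub>R a + (u *\<^sub>R x + v *\<^sub>R y) *s (w - a)"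
      unfolding \<gamma>_def vec_eq_iff vector_add_component vector_scaleR_component
        vector_smult_component vector_minus_component
      by (simp add: scaleR_conv_of_real algebra_simps)
    ultimately show "u *\<^sub>R x + v *\<^sub>R y \<in> S"
      unfolding S_def vimage_eq using uv by (simp only: \<gamma>_def scaleR_one)
  qed
  have hol: "(\<lambda>\<zeta>. g (\<gamma> \<zeta>)) holomorphic_on S"
    unfolding holomorphic_on_def
  proof
    fix \<zeta> assume "\<zeta> \<in> S"
    then have "\<gamma> \<zeta> \<in> ball z e" unfolding S_def by (rule vimageD)
    then obtain D where D: "(g has_derivative D) (at (\<gamma> \<zeta>))" "\<And>c v. D (c *s v) = c * D v"
      using g unfolding holo_on_def by metis
    have "((\<lambda>\<zeta>. g (\<gamma> \<zeta>)) has_derivative (\<lambda>\<eta>. D (\<eta> *s (w - a)))) (at \<zeta>)"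
      using diff_chain_at[OF \<gamma> D(1)] unfolding o_def .
    moreover have "(\<lambda>\<eta>. D (\<eta> *s (w - a))) = (*) (D (w - a))"
      unfolding D(2) by (rule ext) (rule mult.commute)
    ultimately have "((\<lambda>\<zeta>. g (\<gamma> \<zeta>)) has_field_derivative D (w - a)) (at \<zeta>)"
      unfolding has_field_derivative_def by (simp only:)
    then show "(\<lambda>\<zeta>. g (\<gamma> \<zeta>)) field_differentiable at \<zeta> within S"
      unfolding field_differentiable_def by (intro exI) (rule has_field_derivative_at_within)
  qed
  have "g (\<gamma> 1) = 0"
  proof (rule analytic_continuation_open[of T S "\<lambda>\<zeta>. g (\<gamma> \<zeta>)" "\<lambda>_. 0"])
    have "\<gamma> 0 = a" by (simp add: \<gamma>_def)
    then show "T \<noteq> {}" using a by (auto simp: T_def)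
    show "T \<subseteq> S" using V by (auto simp: S_def T_def)
    show "1 \<in> S" using w by (simp add: S_def \<gamma>_def)
  qed (use \<open>open S\<close> \<open>open T\<close> \<open>convex S\<close> hol V in \<open>auto simp: convex_connected T_def\<close>)
  then show ?thesis by (simp add: \<gamma>_def)
qed

lemma merom_inverse:
  assumes "merom f"
  shows "merom (\<lambda>z. inverse (f z))"
  unfolding merom_def
proof
  fix z
  from meromE[OF assms, of z] obtain e g k where U: "e > 0" "holo_on g (ball z e)"
    "holo_on k (ball z e)" "nondegenerate_on k (ball z e)"
    "\<And>w. w \<in> ball z e \<Longrightarrow> k w \<noteq> 0 \<Longrightarrow> f w = g w / k w"
    by metis
  show "\<exists>U g k. open U \<and> z \<in> U \<and> holo_on g U \<and> holo_on k U \<and> nondegenerate_on k U \<and>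
        (\<forall>w\<in>U. k w \<noteq> 0 \<longrightarrow> inverse (f w) = g w / k w)"
  proof (cases "nondegenerate_on g (ball z e)")
    case True
    then show ?thesis
      using U
      by (intro exI[of _ "ball z e"] exI[of _ "\<lambda>w. k w * k w"] exI[of _ "\<lambda>w. k w * g w"])
         (auto intro!: holo_on_mult nondegenerate_on_mult simp del: mem_ball)
  next
    case False
    have "g w = 0" if "w \<in> ball z e" for w using identity_ball[OF U(2) False that] .
    then show ?thesis
      using U by (intro exI[of _ "ball z e"] exI[of _ "\<lambda>w. 0"] exI[of _ k])
         (auto simp: holo_on_const)
  qed
qed

lemma dense_iff: "closure W = UNIV \<longleftrightarrow> (\<forall>V. open V \<and> V \<noteq> {} \<longrightarrow> V \<inter> W \<noteq> {})"
  for W :: "'a::topological_space set"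
proof
  assume "closure W = UNIV"
  then show "\<forall>V. open V \<and> V \<noteq> {} \<longrightarrow> V \<inter> W \<noteq> {}"
    using open_Int_closure_eq_empty by fastforce
next
  assume *: "\<forall>V. open V \<and> V \<noteq> {} \<longrightarrow> V \<inter> W \<noteq> {}"
  have "open (- closure W)" by auto
  moreover have "- closure W \<inter> W = {}" using closure_subset by fastforce
  ultimately show "closure W = UNIV" using * by blast
qed

lemma dense_open_Int:
  fixes V W :: "'a::topological_space set"
  assumes "open V" "closure V = UNIV" "closure W = UNIV"
  shows "closure (V \<inter> W) = UNIV"
  unfolding dense_iff
proof (intro allI impI, elim conjE)
  fix X :: "'a set" assume X: "open X" "X \<noteq> {}"
  have "open (X \<inter> V)" using assms(1) X(1) by (rule open_Int[rotated])
  moreover have "X \<inter> V \<noteq> {}" using assms(2) X unfolding dense_iff by metis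
  ultimately have "X \<inter> V \<inter> W \<noteq> {}" using assms(3) unfolding dense_iff by metis
  then show "X \<inter> (V \<inter> W) \<noteq> {}" by (simp add: Int_assoc)
qed

lemma merom_eqI:
  "merom f \<Longrightarrow> merom f' \<Longrightarrow> open W \<Longrightarrow> closure W = UNIV \<Longrightarrow> (\<And>w. w \<in> W \<Longrightarrow> f w = f' w) \<Longrightarrow>
     merom_eq f f'"
  unfolding merom_eq_def by blast

lemma merom_eq_refl: "merom f \<Longrightarrow> merom_eq f f"
  by (rule merom_eqI[of _ _ UNIV]) auto

lemma merom_eq_refl_iff: "merom_eq f f \<longleftrightarrow> merom f"
  using merom_eq_refl by (auto simp: merom_eq_def)

lemma merom_eq_cong2:
  assumes "merom_eq f f'" "merom_eq g g'"
    and "merom (\<lambda>z. F (f z) (g z))" "merom (\<lambda>z. F (f' z) (g' z))"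
  shows "merom_eq (\<lambda>z. F (f z) (g z)) (\<lambda>z. F (f' z) (g' z))"
proof -
  obtain V W where "open V" "closure V = UNIV" "\<forall>w\<in>V. f w = f' w"
    "open W" "closure W = UNIV" "\<forall>w\<in>W. g w = g' w"
    using assms(1,2) unfolding merom_eq_def by blast
  then show ?thesis
    using assms(3,4) by (intro merom_eqI[of _ _ "V \<inter> W"]) (auto simp: dense_open_Int)
qed

lemma merom_vanish:
  fixes f :: "complex^'n \<Rightarrow> complex"
  assumes f: "merom f" and V: "open V" "V \<noteq> {}" "\<And>w. w \<in> V \<Longrightarrow> f w = 0"
  shows "merom_eq f (\<lambda>_. 0)"
proof -
  define P where "P = (\<lambda>U. open U \<and> (\<exists>W. open W \<and> W \<subseteq> U \<and> U \<subseteq> closure W \<and> (\<forall>w\<in>W. f w = 0)))"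
  define Z where "Z = \<Union>{U. P U}"
  have "open Z" unfolding Z_def P_def by blast
  have "Z \<noteq> {}" using V closure_subset[of V] unfolding Z_def P_def by blast
  have "closure Z \<subseteq> Z"
  proof
    fix z assume z: "z \<in> closure Z"
    from meromE[OF f, of z] obtain e g k where U: "e > 0" "holo_on g (ball z e)"
      "holo_on k (ball z e)" "nondegenerate_on k (ball z e)"
      "\<And>w. w \<in> ball z e \<Longrightarrow> k w \<noteq> 0 \<Longrightarrow> f w = g w / k w"
      by metis
    define K where "K = {w \<in> ball z e. k w \<noteq> 0}"
    have K: "open K" unfolding K_def using open_nonzero[OF _ U(3)] by simp
    have dense: "ball z e \<subseteq> closure K"
    proof (rule ccontr)
      assume "\<not> ball z e \<subseteq> closure K"
      then have "ball z e - closure K \<noteq> {}" "open (ball z e - closure K)" by auto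
      then obtain w where "w \<in> ball z e - closure K" "k w \<noteq> 0"
        using U(4) unfolding nondegenerate_on_def by blast
      then show False using closure_subset[of K] by (auto simp: K_def)
    qed
    have "Z \<inter> ball z e \<noteq> {}"
      using z \<open>e > 0\<close> by (metis Int_commute centre_in_ball disjoint_iff open_Int_closure_eq_empty open_ball)
    then obtain X W where X: "open X" "open W" "W \<subseteq> X" "X \<subseteq> closure W" "\<forall>w\<in>W. f w = 0"
       "X \<inter> ball z e \<noteq> {}"
      unfolding Z_def P_def by blast
    have "W \<inter> (X \<inter> ball z e) \<noteq> {}"
      using X open_Int_closure_eq_empty[of "X \<inter> ball z e" W] by blast
    then have "W \<inter> ball z e \<noteq> {}" by blast
    then have "W \<inter> ball z e \<inter> K \<noteq> {}"
      using X(2) dense open_Int_closure_eq_empty[of "W \<inter> ball z e" K] by blast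
    moreover have "g w = 0" if "w \<in> W \<inter> ball z e \<inter> K" for w
      using U(5)[of w] that X(5) by (auto simp: K_def simp del: mem_ball)
    moreover have "open (W \<inter> ball z e \<inter> K)" using X(2) K by (intro open_Int open_ball)
    ultimately have "\<not> nondegenerate_on g (ball z e)"
      unfolding nondegenerate_on_def by blast
    then have "g w = 0" if "w \<in> ball z e" for w using identity_ball[OF U(2) _ that] by blast
    then have "\<forall>w\<in>K. f w = 0" using U(5) by (auto simp: K_def simp del: mem_ball)
    then have "P (ball z e)" using K dense unfolding P_def K_def by blast
    then show "z \<in> Z" using \<open>e > 0\<close> unfolding Z_def by (metis UnionI centre_in_ball mem_Collect_eq)
  qed
  then have "closed Z" by (simp add: closure_subset_eq)
  then have Z: "Z = UNIV"
    using \<open>open Z\<close> \<open>Z \<noteq> {}\<close> clopen[of Z] by blast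
  define W where "W = \<Union>{W. open W \<and> (\<forall>w\<in>W. f w = 0)}"
  have "closure W = UNIV"
  proof -
    have "z \<in> closure W" for z
    proof -
      obtain U W' where "z \<in> closure W'" "open W'" "\<forall>w\<in>W'. f w = 0"
        using Z unfolding Z_def P_def by blast
      then show ?thesis using closure_mono[of W' W] unfolding W_def by blast
    qed
    then show ?thesis by blast
  qed
  then show ?thesis
    by (intro merom_eqI[of _ _ W] f merom_const) (auto simp: W_def)
qed

lemma merom_eq_inverse:
  assumes f: "merom f" and nz: "\<not> merom_eq f (\<lambda>_. 0)"
  shows "merom_eq (\<lambda>z. inverse (f z) * f z) (\<lambda>_. 1)"
proof -
  define W where "W = interior {z. f z \<noteq> 0}"
  have "V \<inter> W \<noteq> {}" if V: "open V" "V \<noteq> {}" for V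
  proof -
    obtain z where "z \<in> V" using V by auto
    from meromE[OF f, of z] obtain e g k where U: "e > 0" "holo_on g (ball z e)"
      "holo_on k (ball z e)" "nondegenerate_on k (ball z e)"
      "\<And>w. w \<in> ball z e \<Longrightarrow> k w \<noteq> 0 \<Longrightarrow> f w = g w / k w"
      by metis
    have "open (V \<inter> ball z e)" "z \<in> V \<inter> ball z e" using V \<open>z \<in> V\<close> U(1) by auto
    then obtain w where w: "w \<in> V \<inter> ball z e" "k w \<noteq> 0"
      using U(4) unfolding nondegenerate_on_def by blast
    define K where "K = V \<inter> {w \<in> ball z e. k w \<noteq> 0}"
    have K: "open K" "K \<noteq> {}"
      using open_nonzero[OF _ U(3)] V w by (auto simp: K_def)
    obtain w' where w': "w' \<in> K" "f w' \<noteq> 0"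
      using merom_vanish[OF f K] nz by blast
    define L where "L = V \<inter> {w \<in> ball z e. k w * g w \<noteq> 0}"
    have "open L" unfolding L_def
      using open_nonzero[OF _ holo_on_mult[OF U(3,2)]] V by auto
    moreover have "L \<subseteq> {z. f z \<noteq> 0}" using U(5) by (auto simp: L_def simp del: mem_ball)
    ultimately have "L \<subseteq> W" unfolding W_def by (rule interior_maximal[rotated])
    moreover have "w' \<in> L" using w' U(5)[of w'] by (auto simp: K_def L_def simp del: mem_ball)
    ultimately show ?thesis by (auto simp: L_def)
  qed
  then have "closure W = UNIV" unfolding dense_iff by blast
  moreover have "\<forall>w\<in>W. f w \<noteq> 0" using interior_subset by (fastforce simp: W_def)
  ultimately show ?thesis
    by (intro merom_eqI[of _ _ W] merom_mult merom_inverse f merom_const) (auto simp: W_def)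
qed

quotient_type (overloaded) 'n mero = "complex^'n::finite \<Rightarrow> complex" / partial: merom_eq
proof (rule part_equivpI)
  show "\<exists>f::complex^'n \<Rightarrow> complex. merom_eq f f"
    using merom_eq_refl[OF merom_const] by blast
  show "symp (merom_eq :: (complex^'n \<Rightarrow> complex) \<Rightarrow> _)"
    unfolding symp_def merom_eq_def by metis
  show "transp (merom_eq :: (complex^'n \<Rightarrow> complex) \<Rightarrow> _)"
  proof (rule transpI)
    fix f g h :: "complex^'n \<Rightarrow> complex"
    assume *: "merom_eq f g" "merom_eq g h"
    then obtain V W where "open V" "closure V = UNIV" "\<forall>w\<in>V. f w = g w"
      "open W" "closure W = UNIV" "\<forall>w\<in>W. g w = h w"
      unfolding merom_eq_def by blast
    then show "merom_eq f h"
      using * by (intro merom_eqI[of _ _ "V \<inter> W"]) (auto simp: dense_open_Int merom_eq_def)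
  qed
qed

instantiation mero :: (finite) field
begin

lift_definition zero_mero :: "'a mero" is "\<lambda>_. 0"
  by (intro merom_eq_refl merom_const)

lift_definition one_mero :: "'a mero" is "\<lambda>_. 1"
  by (intro merom_eq_refl merom_const)

lift_definition plus_mero :: "'a mero \<Rightarrow> 'a mero \<Rightarrow> 'a mero" is "\<lambda>f g z. f z + g z"
  by (rule merom_eq_cong2[where F = "(+)"], assumption, assumption)
     (simp_all add: merom_eq_def merom_add)

lift_definition times_mero :: "'a mero \<Rightarrow> 'a mero \<Rightarrow> 'a mero" is "\<lambda>f g z. f z * g z"
  by (rule merom_eq_cong2[where F = "(*)"], assumption, assumption)
     (simp_all add: merom_eq_def merom_mult)

lift_definition uminus_mero :: "'a mero \<Rightarrow> 'a mero" is "\<lambda>f z. - f z"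
  by (rule merom_eq_cong2[where F = "\<lambda>x _. - x"], assumption, assumption)
     (simp_all add: merom_eq_def merom_uminus)

lift_definition inverse_mero :: "'a mero \<Rightarrow> 'a mero" is "\<lambda>f z. inverse (f z)"
  by (rule merom_eq_cong2[where F = "\<lambda>x _. inverse x"], assumption, assumption)
     (simp_all add: merom_eq_def merom_inverse)

definition minus_mero :: "'a mero \<Rightarrow> 'a mero \<Rightarrow> 'a mero" where "minus_mero f g = f + - g"

definition divide_mero :: "'a mero \<Rightarrow> 'a mero \<Rightarrow> 'a mero" where "divide_mero f g = f * inverse g"

instance
proof
  fix a b c :: "'a mero"
  show "a + b + c = a + (b + c)" by transfer (simp add: merom_eq_refl_iff merom_add merom_mult merom_uminus merom_const add.assoc)
  show "a + b = b + a" by transfer (simp add: merom_eq_refl_iff merom_add merom_mult merom_uminus merom_const add.commute)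
  show "0 + a = a" by transfer (simp add: merom_eq_refl_iff merom_add merom_mult merom_uminus merom_const )
  show "- a + a = 0" by transfer (simp add: merom_eq_refl_iff merom_add merom_mult merom_uminus merom_const )
  show "a - b = a + - b" by (simp add: minus_mero_def)
  show "a * b * c = a * (b * c)" by transfer (simp add: merom_eq_refl_iff merom_add merom_mult merom_uminus merom_const mult.assoc)
  show "a * b = b * a" by transfer (simp add: merom_eq_refl_iff merom_add merom_mult merom_uminus merom_const mult.commute)
  show "1 * a = a" by transfer (simp add: merom_eq_refl_iff merom_add merom_mult merom_uminus merom_const )
  show "(a + b) * c = a * c + b * c" by transfer (simp add: merom_eq_refl_iff merom_add merom_mult merom_uminus merom_const distrib_right)
  show "a div b = a * inverse b" by (simp add: divide_mero_def)
  show "inverse (0::'a mero) = 0" by transfer (simp add: merom_eq_refl_iff merom_add merom_mult merom_uminus merom_const )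
  show "(0::'a mero) \<noteq> 1"
  proof (transfer, rule notI)
    assume "merom_eq (\<lambda>_::complex^'a. 0) (\<lambda>_. 1)"
    then obtain W :: "(complex^'a) set" where "closure W = UNIV" "\<forall>w\<in>W. (0::complex) = 1"
      unfolding merom_eq_def by blast
    then show False by auto
  qed
  show "a \<noteq> 0 \<Longrightarrow> inverse a * a = 1" by transfer (simp add: merom_eq_inverse merom_eq_refl_iff)
qed

end

lift_definition mero_const :: "complex \<Rightarrow> 'n::finite mero" is "\<lambda>c _. c"
  by (intro merom_eq_refl merom_const)

lemma has_derivative_translate:
  "(f has_derivative D) (at (z + a)) \<Longrightarrow> ((\<lambda>z. f (z + a)) has_derivative D) (at z)"
proof -
  assume f: "(f has_derivative D) (at (z + a))"
  have "((\<lambda>z. z + a) has_derivative (\<lambda>v. v)) (at z)"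
    by (auto intro!: derivative_eq_intros)
  from diff_chain_at[OF this f] show ?thesis unfolding o_def .
qed

lemma holo_on_translate:
  assumes "holo_on f U"
  shows "holo_on (\<lambda>z. f (z + a)) ((\<lambda>z. z + a) -` U)"
  unfolding holo_on_def vimage_eq
proof
  fix z assume "z \<in> (\<lambda>z. z + a) -` U"
  then obtain D where "(f has_derivative D) (at (z + a))" "\<forall>c v. D (c *s v) = c * D v"
    using assms unfolding holo_on_def by auto
  then show "\<exists>D. ((\<lambda>z. f (z + a)) has_derivative D) (at z) \<and> (\<forall>c v. D (c *s v) = c * D v)"
    using has_derivative_translate by (intro exI[of _ D]) simp
qed

lemma open_translate: "open U \<Longrightarrow> open ((\<lambda>z. z + a) -` U)"
  for a :: "'a::real_normed_vector"
  by (rule open_vimage, assumption) (intro continuous_intros)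

lemma vimage_translate_minus: "(\<lambda>z. z - a) -` V \<subseteq> U \<longleftrightarrow> V \<subseteq> (\<lambda>z. z + a) -` U"
  for a :: "'a::real_normed_vector"
proof
  assume L: "(\<lambda>z. z - a) -` V \<subseteq> U"
  show "V \<subseteq> (\<lambda>z. z + a) -` U"
  proof
    fix v assume "v \<in> V"
    then have "v + a \<in> (\<lambda>z. z - a) -` V" by simp
    then show "v \<in> (\<lambda>z. z + a) -` U" using L by blast
  qed
next
  assume R: "V \<subseteq> (\<lambda>z. z + a) -` U"
  show "(\<lambda>z. z - a) -` V \<subseteq> U"
  proof
    fix u assume "u \<in> (\<lambda>z. z - a) -` V"
    then have "u - a \<in> (\<lambda>z. z + a) -` U" using R by blast
    then show "u \<in> U" by simp
  qed
qed

lemma nondegenerate_on_translate: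
  assumes "nondegenerate_on k U"
  shows "nondegenerate_on (\<lambda>z. k (z + a)) ((\<lambda>z. z + a) -` U)"
  unfolding nondegenerate_on_def
proof (intro allI impI, elim conjE)
  fix V assume V: "open V" "V \<subseteq> (\<lambda>z. z + a) -` U" "V \<noteq> {}"
  let ?V = "(\<lambda>z. z - a) -` V"
  have "open ?V" using open_translate[OF V(1), of "- a"] by simp
  moreover have "?V \<subseteq> U" using V(2) vimage_translate_minus by metis
  moreover obtain v where "v \<in> V" using V(3) by blast
  then have "v + a \<in> ?V" by simp
  then have "?V \<noteq> {}" by blast
  ultimately obtain w where "w \<in> ?V" "k w \<noteq> 0"
    using assms unfolding nondegenerate_on_def by metis
  then show "\<exists>w\<in>V. k (w + a) \<noteq> 0" by (intro bexI[of _ "w - a"]) simp_all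
qed

lemma merom_translate:
  assumes "merom f"
  shows "merom (\<lambda>z. f (z + a))"
  unfolding merom_def
proof
  fix z
  obtain U g k where U: "open U" "z + a \<in> U" "holo_on g U" "holo_on k U" "nondegenerate_on k U"
        "\<forall>w\<in>U. k w \<noteq> 0 \<longrightarrow> f w = g w / k w"
    using assms unfolding merom_def by metis
  show "\<exists>U g k. open U \<and> z \<in> U \<and> holo_on g U \<and> holo_on k U \<and> nondegenerate_on k U \<and>
        (\<forall>w\<in>U. k w \<noteq> 0 \<longrightarrow> f (w + a) = g w / k w)"
    using U(2,6)
    by (intro exI[of _ "(\<lambda>z. z + a) -` U"] exI[of _ "\<lambda>z. g (z + a)"] exI[of _ "\<lambda>z. k (z + a)"]
          conjI open_translate holo_on_translate nondegenerate_on_translate U(1,3,4,5)) simp_all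
qed

lift_definition mero_shift :: "'n::finite \<Rightarrow> 'n mero \<Rightarrow> 'n mero" is "\<lambda>i f z. f (z + axis i 1)"
proof -
  fix i :: 'n and f f' :: "complex^'n \<Rightarrow> complex"
  assume *: "merom_eq f f'"
  then obtain W where W: "open W" "closure W = UNIV" "\<forall>w\<in>W. f w = f' w"
    unfolding merom_eq_def by blast
  let ?a = "axis i 1 :: complex^'n"
  have dense: "closure ((\<lambda>z. z + ?a) -` W) = UNIV"
    unfolding dense_iff
  proof (intro allI impI, elim conjE)
    fix V :: "(complex^'n) set" assume V: "open V" "V \<noteq> {}"
    have "open ((\<lambda>z. z - ?a) -` V)" using open_translate[OF V(1), of "- ?a"] by simp
    moreover obtain v where "v \<in> V" using V(2) by blast
    then have "v + ?a \<in> (\<lambda>z. z - ?a) -` V" by simp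
    then have "(\<lambda>z. z - ?a) -` V \<noteq> {}" by blast
    ultimately obtain w where "w \<in> (\<lambda>z. z - ?a) -` V \<inter> W"
      using W(2) unfolding dense_iff by (metis ex_in_conv)
    then have "w - ?a \<in> V \<inter> (\<lambda>z. z + ?a) -` W" by simp
    then show "V \<inter> (\<lambda>z. z + ?a) -` W \<noteq> {}" by blast
  qed
  show "merom_eq (\<lambda>z. f (z + ?a)) (\<lambda>z. f' (z + ?a))"
  proof (rule merom_eqI[OF _ _ open_translate[OF W(1)] dense])
    show "merom (\<lambda>z. f (z + ?a))" "merom (\<lambda>z. f' (z + ?a))"
      using * by (intro merom_translate; simp add: merom_eq_def)+
    show "f (w + ?a) = f' (w + ?a)" if "w \<in> (\<lambda>z. z + ?a) -` W" for w
      using that W(3) unfolding vimage_eq by blast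
  qed
qed

text \<open>The function \<open>q\<^bsup>-2(\<lambda>\<^sub>i - \<lambda>\<^sub>j)\<^esup>\<close>, for the principal branch of the logarithm of \<open>q\<close>.\<close>

lift_definition q_pow :: "complex \<Rightarrow> 'n::finite \<Rightarrow> 'n \<Rightarrow> 'n mero" is
  "\<lambda>q i j z. q powr (- 2 * (z $ i - z $ j))"
proof -
  fix q :: complex and i j :: 'n
  have lin: "bounded_linear (\<lambda>z::complex^'n. z $ m)" for m
    by (rule bounded_linear_vec_nth)
  let ?L = "\<lambda>z::complex^'n. - 2 * (z $ i - z $ j) * Ln q"
  have L: "(?L has_derivative ?L) (at z)" for z
    by (intro bounded_linear_imp_has_derivative bounded_linear_mult_const[OF bounded_linear_const_mult]
          bounded_linear_sub lin)
  have "holo_on (\<lambda>z::complex^'n. exp (?L z)) UNIV"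
    unfolding holo_on_def
  proof
    fix z :: "complex^'n"
    have "((\<lambda>z. exp (?L z)) has_derivative (\<lambda>v. exp (?L z) * ?L v)) (at z)"
      using diff_chain_at[OF L DERIV_exp[unfolded has_field_derivative_def]] unfolding o_def .
    moreover have "\<forall>c v. exp (?L z) * ?L (c *s v) = c * (exp (?L z) * ?L v)"
      by (simp add: algebra_simps)
    ultimately show "\<exists>D. ((\<lambda>z. exp (?L z)) has_derivative D) (at z) \<and>
        (\<forall>c v. D (c *s v) = c * D v)" by blast
  qed
  then have "merom (\<lambda>z::complex^'n. q powr (- 2 * (z $ i - z $ j)))"
    by (cases "q = 0") (simp_all add: powr_def merom_const merom_holo)
  then show "merom_eq (\<lambda>z::complex^'n. q powr (- 2 * (z $ i - z $ j)))
     (\<lambda>z. q powr (- 2 * (z $ i - z $ j)))" by (rule merom_eq_refl)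
qed

text \<open>
  With \<open>h(x) = q (q\<^bsup>-2x\<^esup> - q\<^bsup>-2\<^esup>) / (q\<^bsup>-2x\<^esup> - 1)\<close> and \<open>g(x) = h(x) h(-x)\<close>, these are the functions
  \<open>h(\<lambda>\<^sub>i - \<lambda>\<^sub>j)\<close> and \<open>g(\<lambda>\<^sub>i - \<lambda>\<^sub>j)\<close>; only \<open>i \<noteq> j\<close> is meaningful.
\<close>

definition dyn_h :: "complex \<Rightarrow> 'n::finite \<Rightarrow> 'n \<Rightarrow> 'n mero" where
  "dyn_h q i j =
     mero_const q * (q_pow q i j - mero_const (q powi - 2)) / (q_pow q i j - 1)"

definition dyn_g :: "complex \<Rightarrow> 'n::finite \<Rightarrow> 'n \<Rightarrow> 'n mero" where
  "dyn_g q i j = dyn_h q i j * dyn_h q j i"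


section \<open>Algebras by generators and relations, tensor products\<close>

text \<open>
  Unital associative complex algebras are records of type \<^typ>\<open>(complex, 'a) module\<close>. Both free
  algebras and tensor products arise as quotients of monoid algebras.
\<close>

definition monoid_algebra :: "('a, 'm) monoid_scheme \<Rightarrow> (complex, 'a \<Rightarrow>\<^sub>0 complex) module" where
  "monoid_algebra G =
     \<lparr>carrier = {p. Poly_Mapping.keys p \<subseteq> carrier G},
      mult = (\<lambda>p r. \<Sum>x\<in>Poly_Mapping.keys p. \<Sum>y\<in>Poly_Mapping.keys r.
        Poly_Mapping.single (x \<otimes>\<^bsub>G\<^esub> y) (Poly_Mapping.lookup p x * Poly_Mapping.lookup r y)),
      one = Poly_Mapping.single \<one>\<^bsub>G\<^esub> 1, zero = 0, add = (+),
      smult = (\<lambda>c. Poly_Mapping.map ((*) c))\<rparr>"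

definition quotient_algebra :: "(complex, 'a) module \<Rightarrow> 'a set \<Rightarrow> (complex, 'a set) module" where
  "quotient_algebra A I =
     \<lparr>carrier = a_rcosets\<^bsub>A\<^esub> I, mult = rcoset_mult A I, one = I +>\<^bsub>A\<^esub> \<one>\<^bsub>A\<^esub>, zero = I, add = set_add A,
      smult = (\<lambda>c X. \<Union>x\<in>X. I +>\<^bsub>A\<^esub> (c \<odot>\<^bsub>A\<^esub> x))\<rparr>"

text \<open>A relation \<open>x = y\<close> is given as the pair \<open>(x, y)\<close>; \<^const>\<open>genideal\<close> is the two-sided ideal.\<close>

definition relation_ideal ::
  "('a, 'm) monoid_scheme \<Rightarrow> (('a \<Rightarrow>\<^sub>0 complex) \<times> ('a \<Rightarrow>\<^sub>0 complex)) set \<Rightarrow> ('a \<Rightarrow>\<^sub>0 complex) set" where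
  "relation_ideal G E = Idl\<^bsub>monoid_algebra G\<^esub> {x - y |x y. (x, y) \<in> E}"

definition presented_algebra ::
  "('a, 'm) monoid_scheme \<Rightarrow> (('a \<Rightarrow>\<^sub>0 complex) \<times> ('a \<Rightarrow>\<^sub>0 complex)) set \<Rightarrow>
     (complex, ('a \<Rightarrow>\<^sub>0 complex) set) module" where
  "presented_algebra G E = quotient_algebra (monoid_algebra G) (relation_ideal G E)"

definition residue_class ::
  "('a, 'm) monoid_scheme \<Rightarrow> (('a \<Rightarrow>\<^sub>0 complex) \<times> ('a \<Rightarrow>\<^sub>0 complex)) set \<Rightarrow>
     ('a \<Rightarrow>\<^sub>0 complex) \<Rightarrow> ('a \<Rightarrow>\<^sub>0 complex) set" where
  "residue_class G E x = relation_ideal G E +>\<^bsub>monoid_algebra G\<^esub> x"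

definition free_monoid :: "'a set \<Rightarrow> 'a list monoid" where
  "free_monoid X = \<lparr>carrier = lists X, mult = (@), one = []\<rparr>"

abbreviation word :: "'a list \<Rightarrow> ('a list \<Rightarrow>\<^sub>0 complex)" where
  "word xs \<equiv> Poly_Mapping.single xs 1"

text \<open>
  The tensor product \<open>A \<otimes> B\<close> over the complex numbers: the monoid algebra of \<open>A \<times> B\<close> (whose product
  is the factorwise one) modulo bilinearity.
\<close>

inductive_set bilinear_relations ::
  "(complex, 'a) module \<Rightarrow> (complex, 'b) module \<Rightarrow>
     (('a \<times> 'b \<Rightarrow>\<^sub>0 complex) \<times> ('a \<times> 'b \<Rightarrow>\<^sub>0 complex)) set"
  for A :: "(complex, 'a) module" and B :: "(complex, 'b) module" where
  add_left: "a \<in> carrier A \<Longrightarrow> a' \<in> carrier A \<Longrightarrow> b \<in> carrier B \<Longrightarrow>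
    (Poly_Mapping.single (a \<oplus>\<^bsub>A\<^esub> a', b) 1,
     Poly_Mapping.single (a, b) 1 + Poly_Mapping.single (a', b) 1) \<in> bilinear_relations A B"
| add_right: "a \<in> carrier A \<Longrightarrow> b \<in> carrier B \<Longrightarrow> b' \<in> carrier B \<Longrightarrow>
    (Poly_Mapping.single (a, b \<oplus>\<^bsub>B\<^esub> b') 1,
     Poly_Mapping.single (a, b) 1 + Poly_Mapping.single (a, b') 1) \<in> bilinear_relations A B"
| smult_left: "a \<in> carrier A \<Longrightarrow> b \<in> carrier B \<Longrightarrow>
    (Poly_Mapping.single (c \<odot>\<^bsub>A\<^esub> a, b) 1, Poly_Mapping.single (a, b) c) \<in> bilinear_relations A B"
| smult_right: "a \<in> carrier A \<Longrightarrow> b \<in> carrier B \<Longrightarrow>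
    (Poly_Mapping.single (a, c \<odot>\<^bsub>B\<^esub> b) 1, Poly_Mapping.single (a, b) c) \<in> bilinear_relations A B"

definition tensor_algebra ::
  "(complex, 'a) module \<Rightarrow> (complex, 'b) module \<Rightarrow> (complex, ('a \<times> 'b \<Rightarrow>\<^sub>0 complex) set) module" where
  "tensor_algebra A B = presented_algebra (A \<times>\<times> B) (bilinear_relations A B)"

definition tensor ::
  "(complex, 'a) module \<Rightarrow> (complex, 'b) module \<Rightarrow> 'a \<Rightarrow> 'b \<Rightarrow> ('a \<times> 'b \<Rightarrow>\<^sub>0 complex) set" where
  "tensor A B a b = residue_class (A \<times>\<times> B) (bilinear_relations A B) (Poly_Mapping.single (a, b) 1)"

definition ordered_prod :: "('a, 'm) monoid_scheme \<Rightarrow> 'a list \<Rightarrow> 'a" where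
  "ordered_prod G xs = foldr (mult G) xs \<one>\<^bsub>G\<^esub>"


section \<open>The algebra of dynamical quantum matrices\<close>

text \<open>
  The index set \<open>{1, \<dots>, N}\<close> is an arbitrary finite linearly ordered type \<open>'n\<close>, with
  \<open>N = CARD('n)\<close>. \<open>LeftFun f\<close> and \<open>RightFun f\<close> stand for \<open>f(\<lambda>) = \<mu>\<^sub>l(f)\<close> and \<open>f(\<mu>) = \<mu>\<^sub>r(f)\<close>.
\<close>

datatype ('i, 'f) fr_gen = TGen 'i 'i | LeftFun 'f | RightFun 'f

text \<open>
  The last relation is the member of the RTT relations that follows from \<open>comm\<close> and \<open>gcomm\<close> only
  after cancelling the factor \<open>h(\<lambda>\<^sub>j - \<lambda>\<^sub>i) - h(\<mu>\<^sub>k - \<mu>\<^sub>l)\<close>, which is not invertible in the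
  presented algebra. It expresses that the \<open>2 \<times> 2\<close> minors do not depend on the order of the columns.
\<close>

inductive_set fr_relations ::
  "complex \<Rightarrow> ((('n::{finite,linorder}, 'n mero) fr_gen list \<Rightarrow>\<^sub>0 complex) \<times>
                (('n, 'n mero) fr_gen list \<Rightarrow>\<^sub>0 complex)) set"
  for q :: complex where
  left_add: "(word [LeftFun (f + f')], word [LeftFun f] + word [LeftFun f']) \<in> fr_relations q"
| left_mult: "(word [LeftFun (f * f')], word [LeftFun f, LeftFun f']) \<in> fr_relations q"
| left_const: "(word [LeftFun (mero_const c)], Poly_Mapping.single [] c) \<in> fr_relations q"
| right_add: "(word [RightFun (f + f')], word [RightFun f] + word [RightFun f']) \<in> fr_relations q"
| right_mult: "(word [RightFun (f * f')], word [RightFun f, RightFun f']) \<in> fr_relations q"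
| right_const: "(word [RightFun (mero_const c)], Poly_Mapping.single [] c) \<in> fr_relations q"
| left_right: "(word [LeftFun f, RightFun f'], word [RightFun f', LeftFun f]) \<in> fr_relations q"
| left_shift: "(word [LeftFun f, TGen i j], word [TGen i j, LeftFun (mero_shift i f)])
    \<in> fr_relations q"
| right_shift: "(word [RightFun f, TGen i j], word [TGen i j, RightFun (mero_shift j f)])
    \<in> fr_relations q"
| row: "k < l \<Longrightarrow>
    (word [RightFun (dyn_h q k l), TGen i k, TGen i l], word [TGen i l, TGen i k])
    \<in> fr_relations q"
| column: "i < j \<Longrightarrow>
    (word [LeftFun (dyn_h q j i), TGen j k, TGen i k], word [TGen i k, TGen j k])
    \<in> fr_relations q"
| comm: "i < j \<Longrightarrow> k < l \<Longrightarrow>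
    (word [TGen i k, TGen j l],
     word [TGen j l, TGen i k]
       + (word [LeftFun (dyn_h q j i), TGen j k, TGen i l]
          - word [RightFun (dyn_h q k l), TGen j k, TGen i l]))
    \<in> fr_relations q"
| gcomm: "i < j \<Longrightarrow> k < l \<Longrightarrow>
    (word [RightFun (dyn_g q k l), TGen i k, TGen j l],
     word [LeftFun (dyn_g q i j), TGen j l, TGen i k]
       + (word [RightFun (dyn_h q l k), TGen i l, TGen j k]
          - word [LeftFun (dyn_h q i j), TGen i l, TGen j k]))
    \<in> fr_relations q"
| cross: "i < j \<Longrightarrow> k < l \<Longrightarrow>
    (word [RightFun (dyn_g q k l), TGen j k, TGen i l],
     word [TGen i l, TGen j k]
       + (word [RightFun (dyn_h q l k), TGen j l, TGen i k]
          - word [LeftFun (dyn_h q j i), TGen j l, TGen i k]))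
    \<in> fr_relations q"

type_synonym 'n fr_elem = "(('n, 'n mero) fr_gen list \<Rightarrow>\<^sub>0 complex) set"

definition FR :: "complex \<Rightarrow> (complex, 'n::{finite,linorder} fr_elem) module" where
  "FR q = presented_algebra (free_monoid UNIV) (fr_relations q)"

definition t_gen :: "complex \<Rightarrow> 'n::{finite,linorder} \<Rightarrow> 'n \<Rightarrow> 'n fr_elem" where
  "t_gen q i j = residue_class (free_monoid UNIV) (fr_relations q) (word [TGen i j])"

definition mu_l :: "complex \<Rightarrow> 'n mero \<Rightarrow> 'n::{finite,linorder} fr_elem" where
  "mu_l q f = residue_class (free_monoid UNIV) (fr_relations q) (word [LeftFun f])"

definition mu_r :: "complex \<Rightarrow> 'n mero \<Rightarrow> 'n::{finite,linorder} fr_elem" where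
  "mu_r q f = residue_class (free_monoid UNIV) (fr_relations q) (word [RightFun f])"


section \<open>Minors and determinant\<close>

text \<open>
  Positions are numbered from \<open>0\<close>: for \<open>I = {i\<^sub>0 < \<dots> < i\<^sub>r\<^sub>-\<^sub>1}\<close>, \<open>nth_elem I k\<close> is \<open>i\<^sub>k\<close> and
  permutations act on \<open>{..<r}\<close>.
\<close>

definition nth_elem :: "'n::linorder set \<Rightarrow> nat \<Rightarrow> 'n" where
  "nth_elem I k = sorted_list_of_set I ! k"

definition dyn_S :: "complex \<Rightarrow> (nat \<Rightarrow> nat) \<Rightarrow> 'n::{finite,linorder} set \<Rightarrow> 'n mero" where
  "dyn_S q \<sigma> I =
     (\<Prod>(k, l) \<in> {(k, l). k < l \<and> l < card I \<and> \<sigma> k > \<sigma> l}.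
        - dyn_h q (nth_elem I (\<sigma> k)) (nth_elem I (\<sigma> l)))"

definition minor_wrt ::
  "complex \<Rightarrow> (nat \<Rightarrow> nat) \<Rightarrow> 'n set \<Rightarrow> 'n set \<Rightarrow> 'n::{finite,linorder} fr_elem" where
  "minor_wrt q \<rho> I J =
     mu_r q (inverse (dyn_S q \<rho> J)) \<otimes>\<^bsub>FR q\<^esub>
     finsum (FR q)
       (\<lambda>\<sigma>. mu_l q (dyn_S q \<sigma> I) \<otimes>\<^bsub>FR q\<^esub>
          ordered_prod (FR q)
            (map (\<lambda>k. t_gen q (nth_elem I (\<sigma> k)) (nth_elem J (\<rho> k))) [0..<card I]))
       {\<sigma>. \<sigma> permutes {..<card I}}"

text \<open>\<^const>\<open>minor_wrt\<close> does not depend on \<open>\<rho>\<close>; for \<open>\<rho> = id\<close> the first factor is \<open>1\<close>.\<close>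

definition dyn_minor ::
  "complex \<Rightarrow> 'n set \<Rightarrow> 'n set \<Rightarrow> 'n::{finite,linorder} fr_elem" where
  "dyn_minor q = minor_wrt q id"

definition dyn_det :: "complex \<Rightarrow> 'n::{finite,linorder} fr_elem" where
  "dyn_det q = dyn_minor q UNIV UNIV"


section \<open>The algebra generated by the \<open>b\<^sub>i\<^sub>j\<close>\<close>

datatype ('i, 'f) b_gen = BGen 'i 'i | BFun 'f

inductive_set b_relations ::
  "((('n::{finite,linorder}, 'n mero) b_gen list \<Rightarrow>\<^sub>0 complex) \<times>
    (('n, 'n mero) b_gen list \<Rightarrow>\<^sub>0 complex)) set" where
  add: "(word [BFun (f + f')], word [BFun f] + word [BFun f']) \<in> b_relations"
| mult: "(word [BFun (f * f')], word [BFun f, BFun f']) \<in> b_relations"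
| const: "(word [BFun (mero_const c)], Poly_Mapping.single [] c) \<in> b_relations"

type_synonym 'n b_elem = "(('n, 'n mero) b_gen list \<Rightarrow>\<^sub>0 complex) set"

definition b_generators :: "('n::{finite,linorder}, 'n mero) b_gen set" where
  "b_generators = {BGen i j |i j. i < j} \<union> range BFun"

definition Balg :: "(complex, 'n::{finite,linorder} b_elem) module" where
  "Balg = presented_algebra (free_monoid b_generators) b_relations"

definition b_elt :: "'n \<Rightarrow> 'n \<Rightarrow> 'n::{finite,linorder} b_elem" where
  "b_elt i j = residue_class (free_monoid b_generators) b_relations (word [BGen i j])"

definition b_fun :: "'n mero \<Rightarrow> 'n::{finite,linorder} b_elem" where
  "b_fun f = residue_class (free_monoid b_generators) b_relations (word [BFun f])"


section \<open>The dynamical tensor product and Pfaffians\<close>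

text \<open>
  Factorwise products are formed in \<open>T = F\<^sub>R \<otimes> B\<close>, the tensor product over the complex numbers. The
  span \<open>K\<close> of the elements \<open>\<mu>\<^sub>r(f)t \<otimes> b - t \<otimes> fb\<close> is a right ideal of \<open>T\<close>, stable under left
  multiplication by \<open>\<mu>\<^sub>l(f) \<otimes> 1\<close>, and the dynamical tensor product is \<open>T/K\<close>. (\<open>K\<close> is not a left
  ideal; the two-sided ideal it generates contains every \<open>t\<^sub>i\<^sub>j \<otimes> 1\<close>.) The additive subgroup generated
  by these elements is a complex subspace, since scalars can be absorbed in \<open>t\<close>.
\<close>

type_synonym 'n fb_elem = "('n fr_elem \<times> 'n b_elem \<Rightarrow>\<^sub>0 complex) set"

definition FB :: "complex \<Rightarrow> (complex, 'n::{finite,linorder} fb_elem) module" where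
  "FB q = tensor_algebra (FR q) Balg"

definition fb_tensor :: "complex \<Rightarrow> 'n fr_elem \<Rightarrow> 'n b_elem \<Rightarrow> 'n::{finite,linorder} fb_elem" where
  "fb_tensor q = tensor (FR q) Balg"

definition balancing :: "complex \<Rightarrow> 'n::{finite,linorder} fb_elem set" where
  "balancing q = generate (add_monoid (FB q))
     {fb_tensor q (mu_r q f \<otimes>\<^bsub>FR q\<^esub> t) b \<ominus>\<^bsub>FB q\<^esub> fb_tensor q t (b_fun f \<otimes>\<^bsub>Balg\<^esub> b) |f t b.
        t \<in> carrier (FR q) \<and> b \<in> carrier Balg}"

definition dyn_class :: "complex \<Rightarrow> 'n fb_elem \<Rightarrow> 'n::{finite,linorder} fb_elem set" where
  "dyn_class q x = balancing q +>\<^bsub>FB q\<^esub> x"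

text \<open>
  The Pfaffian with entries in an algebra \<open>A\<close> on which a function \<open>f\<close> acts by left multiplication
  with \<open>emb f\<close>. Only the entries \<open>x i j\<close> with \<open>i < j\<close> occur.
\<close>

definition pairing_perms :: "nat \<Rightarrow> (nat \<Rightarrow> nat) set" where
  "pairing_perms n = {\<sigma>. \<sigma> permutes {..<2 * n} \<and> (\<forall>k<n. \<sigma> (2 * k) < \<sigma> (2 * k + 1))}"

definition dyn_Pf ::
  "complex \<Rightarrow> (complex, 'a) module \<Rightarrow> ('n mero \<Rightarrow> 'a) \<Rightarrow> ('n::{finite,linorder} \<Rightarrow> 'n \<Rightarrow> 'a) \<Rightarrow> 'a" where
  "dyn_Pf q A emb x =
     finsum A
       (\<lambda>\<sigma>. emb (dyn_S q \<sigma> UNIV) \<otimes>\<^bsub>A\<^esub>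
          ordered_prod A
            (map (\<lambda>k. x (nth_elem UNIV (\<sigma> (2 * k))) (nth_elem UNIV (\<sigma> (2 * k + 1))))
              [0..<CARD('n) div 2]))
       (pairing_perms (CARD('n) div 2))"

definition c_elt :: "complex \<Rightarrow> 'n \<Rightarrow> 'n \<Rightarrow> 'n::{finite,linorder} fb_elem" where
  "c_elt q i j =
     finsum (FB q) (\<lambda>(k, l). fb_tensor q (dyn_minor q {i, j} {k, l}) (b_elt k l)) {(k, l). k < l}"

text \<open>The left action \<open>f(t \<otimes> b) = \<mu>\<^sub>l(f)t \<otimes> b\<close> is left multiplication by \<open>fb_fun q f\<close>.\<close>

definition fb_fun :: "complex \<Rightarrow> 'n mero \<Rightarrow> 'n::{finite,linorder} fb_elem" where
  "fb_fun q f = fb_tensor q (mu_l q f) \<one>\<^bsub>Balg\<^esub>"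

end

theory Submission
  imports Defs
begin

text \<open>
  For a word \<open>c\<close> of \<open>N\<close> column indices put
  \<open>D c = \<Sum>\<^sub>\<tau> \<mu>\<^sub>l(S(\<tau>)) t\<^bsub>\<tau>(1)c(1)\<^esub> \<cdots> t\<^bsub>\<tau>(N)c(N)\<^esub>\<close>. Functions of the row indices of a minor commute with
  all generators in other rows, so the summands of \<open>D c\<close> can be grouped in pairs: the permutations
  \<open>\<tau>\<close> and \<open>\<tau> \<circ> (m m+1)\<close> together contribute the \<open>2 \<times> 2\<close> minor of the columns \<open>c(m)\<close> and \<open>c(m+1)\<close>.
  Grouping at all odd \<open>m\<close> simultaneously shows that \<open>D c\<close> is the coefficient of
  \<open>b\<^bsub>c(1)c(2)\<^esub> b\<^bsub>c(3)c(4)\<^esub> \<cdots>\<close> in \<open>Pf(C)\<close>. Grouping at a single \<open>m\<close> and using the exchange relation of the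
  minors, which follows from the relations \<open>comm\<close> and \<open>cross\<close>, sorts the word \<open>c\<close>: it follows that
  \<open>D c = 0\<close> if \<open>c\<close> has a repeated entry, and \<open>D \<rho> = \<mu>\<^sub>r(S(\<rho>)) det(T)\<close> if \<open>\<rho>\<close> is a permutation. The balancing
  relation moves \<open>\<mu>\<^sub>r(S(\<rho>))\<close> to the second factor, where the sum over \<open>\<rho>\<close> is \<open>Pf(B)\<close>.
\<close>

section \<open>Monoid algebras and their quotients\<close>

lemma poly_mapping_sum_singles: "p = (\<Sum>x\<in>Poly_Mapping.keys p. Poly_Mapping.single x (Poly_Mapping.lookup p x))"
  by (rule poly_mapping_eqI)
     (auto simp: lookup_sum lookup_single when_def not_in_keys_iff_lookup_eq_zero)

lemma monoid_algebra_simps [simp]: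
  "carrier (monoid_algebra G) = {p. Poly_Mapping.keys p \<subseteq> carrier G}"
  "\<one>\<^bsub>monoid_algebra G\<^esub> = Poly_Mapping.single \<one>\<^bsub>G\<^esub> 1"
  "\<zero>\<^bsub>monoid_algebra G\<^esub> = 0"
  "p \<oplus>\<^bsub>monoid_algebra G\<^esub> r = p + r"
  "c \<odot>\<^bsub>monoid_algebra G\<^esub> p = Poly_Mapping.map ((*) c) p"
  by (simp_all add: monoid_algebra_def)

text \<open>Terms outside the supports vanish, so larger finite ranges give the same product.
  Distributivity is checked over such common ranges, because the supports of \<open>p\<close>,
  \<open>p'\<close> and \<open>p + p'\<close> differ.\<close>

lemma monoid_algebra_mult_eq_sum:
  assumes "finite A" "finite B" "Poly_Mapping.keys p \<subseteq> A" "Poly_Mapping.keys r \<subseteq> B"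
  shows "p \<otimes>\<^bsub>monoid_algebra G\<^esub> r =
    (\<Sum>x\<in>A. \<Sum>y\<in>B. Poly_Mapping.single (x \<otimes>\<^bsub>G\<^esub> y) (Poly_Mapping.lookup p x * Poly_Mapping.lookup r y))"
proof -
  have "(\<Sum>y\<in>Poly_Mapping.keys r. Poly_Mapping.single (x \<otimes>\<^bsub>G\<^esub> y) (Poly_Mapping.lookup p x * Poly_Mapping.lookup r y))
     = (\<Sum>y\<in>B. Poly_Mapping.single (x \<otimes>\<^bsub>G\<^esub> y) (Poly_Mapping.lookup p x * Poly_Mapping.lookup r y))" for x
    using assms by (intro sum.mono_neutral_left) (auto simp: not_in_keys_iff_lookup_eq_zero)
  moreover have "(\<Sum>x\<in>Poly_Mapping.keys p. \<Sum>y\<in>B. Poly_Mapping.single (x \<otimes>\<^bsub>G\<^esub> y) (Poly_Mapping.lookup p x * Poly_Mapping.lookup r y))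
     = (\<Sum>x\<in>A. \<Sum>y\<in>B. Poly_Mapping.single (x \<otimes>\<^bsub>G\<^esub> y) (Poly_Mapping.lookup p x * Poly_Mapping.lookup r y))"
    using assms by (intro sum.mono_neutral_left) (auto simp: not_in_keys_iff_lookup_eq_zero)
  ultimately show ?thesis by (simp add: monoid_algebra_def)
qed

lemma monoid_algebra_mult_single:
  "Poly_Mapping.single x a \<otimes>\<^bsub>monoid_algebra G\<^esub> Poly_Mapping.single y b = Poly_Mapping.single (x \<otimes>\<^bsub>G\<^esub> y) (a * b)"
  by (subst monoid_algebra_mult_eq_sum[of "{x}" "{y}"]) auto

lemma monoid_algebra_distrib_right:
  "(p + p') \<otimes>\<^bsub>monoid_algebra G\<^esub> r = p \<otimes>\<^bsub>monoid_algebra G\<^esub> r + p' \<otimes>\<^bsub>monoid_algebra G\<^esub> r"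
  using Poly_Mapping.keys_add[of p p']
  by (subst (1 2 3) monoid_algebra_mult_eq_sum[of "Poly_Mapping.keys p \<union> Poly_Mapping.keys p'" "Poly_Mapping.keys r"])
     (auto simp: lookup_add distrib_right single_add sum.distrib)

lemma monoid_algebra_distrib_left:
  "r \<otimes>\<^bsub>monoid_algebra G\<^esub> (p + p') = r \<otimes>\<^bsub>monoid_algebra G\<^esub> p + r \<otimes>\<^bsub>monoid_algebra G\<^esub> p'"
  using Poly_Mapping.keys_add[of p p']
  by (subst (1 2 3) monoid_algebra_mult_eq_sum[of "Poly_Mapping.keys r" "Poly_Mapping.keys p \<union> Poly_Mapping.keys p'"])
     (auto simp: lookup_add distrib_left single_add sum.distrib)

lemma monoid_algebra_mult_zero:
  "0 \<otimes>\<^bsub>monoid_algebra G\<^esub> r = 0" "r \<otimes>\<^bsub>monoid_algebra G\<^esub> 0 = 0"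
  by (simp_all add: monoid_algebra_def)

lemma monoid_algebra_sum_mult:
  "(\<Sum>i\<in>S. f i) \<otimes>\<^bsub>monoid_algebra G\<^esub> r = (\<Sum>i\<in>S. f i \<otimes>\<^bsub>monoid_algebra G\<^esub> r)"
  "r \<otimes>\<^bsub>monoid_algebra G\<^esub> (\<Sum>i\<in>S. f i) = (\<Sum>i\<in>S. r \<otimes>\<^bsub>monoid_algebra G\<^esub> f i)"
  by (induction S rule: infinite_finite_induct)
     (simp_all add: monoid_algebra_mult_zero monoid_algebra_distrib_left monoid_algebra_distrib_right)

lemma monoid_algebra_mult_closed:
  assumes "monoid G" "Poly_Mapping.keys p \<subseteq> carrier G" "Poly_Mapping.keys r \<subseteq> carrier G"
  shows "Poly_Mapping.keys (p \<otimes>\<^bsub>monoid_algebra G\<^esub> r) \<subseteq> carrier G"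
proof
  fix z assume "z \<in> Poly_Mapping.keys (p \<otimes>\<^bsub>monoid_algebra G\<^esub> r)"
  then obtain x y where "x \<in> Poly_Mapping.keys p" "y \<in> Poly_Mapping.keys r" "z = x \<otimes>\<^bsub>G\<^esub> y"
    unfolding monoid_algebra_def
    by (auto dest!: keys_sum[THEN subsetD] split: if_splits)
  then show "z \<in> carrier G" using assms by (auto intro: monoid.m_closed)
qed

lemma monoid_algebra_ring:
  assumes "monoid G"
  shows "ring (monoid_algebra G)"
proof -
  interpret monoid G by fact
  let ?M = "monoid_algebra G"
  \<comment> \<open>By additivity in each factor it suffices to compare monomials, where
    associativity is that of \<open>G\<close> and of complex multiplication.\<close>
  have assoc: "p \<otimes>\<^bsub>?M\<^esub> r \<otimes>\<^bsub>?M\<^esub> s = p \<otimes>\<^bsub>?M\<^esub> (r \<otimes>\<^bsub>?M\<^esub> s)"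
    if "Poly_Mapping.keys p \<subseteq> carrier G" "Poly_Mapping.keys r \<subseteq> carrier G" "Poly_Mapping.keys s \<subseteq> carrier G" for p r s
    using that
    by (subst (1 2) poly_mapping_sum_singles[of p], subst (1 2) poly_mapping_sum_singles[of r],
        subst (1 2) poly_mapping_sum_singles[of s])
       (auto simp: monoid_algebra_sum_mult monoid_algebra_mult_single mult.assoc m_assoc subset_iff
          simp del: in_keys_iff intro!: sum.cong)
  have unit: "Poly_Mapping.single \<one>\<^bsub>G\<^esub> 1 \<otimes>\<^bsub>?M\<^esub> p = p" "p \<otimes>\<^bsub>?M\<^esub> Poly_Mapping.single \<one>\<^bsub>G\<^esub> 1 = p"
    if p: "Poly_Mapping.keys p \<subseteq> carrier G" for p
  proof -
    have "Poly_Mapping.single \<one>\<^bsub>G\<^esub> 1 \<otimes>\<^bsub>?M\<^esub> p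
        = (\<Sum>x\<in>Poly_Mapping.keys p. Poly_Mapping.single x (Poly_Mapping.lookup p x))"
      using p by (subst poly_mapping_sum_singles[of p])
        (auto simp: monoid_algebra_sum_mult monoid_algebra_mult_single intro!: sum.cong)
    then show "Poly_Mapping.single \<one>\<^bsub>G\<^esub> 1 \<otimes>\<^bsub>?M\<^esub> p = p" using poly_mapping_sum_singles[of p] by simp
    have "p \<otimes>\<^bsub>?M\<^esub> Poly_Mapping.single \<one>\<^bsub>G\<^esub> 1
        = (\<Sum>x\<in>Poly_Mapping.keys p. Poly_Mapping.single x (Poly_Mapping.lookup p x))"
      using p by (subst poly_mapping_sum_singles[of p])
        (auto simp: monoid_algebra_sum_mult monoid_algebra_mult_single intro!: sum.cong)
    then show "p \<otimes>\<^bsub>?M\<^esub> Poly_Mapping.single \<one>\<^bsub>G\<^esub> 1 = p" using poly_mapping_sum_singles[of p] by simp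
  qed
  show ?thesis
  proof (rule ringI)
    show "abelian_group ?M"
    proof (rule abelian_groupI)
      show "\<exists>y\<in>carrier ?M. y \<oplus>\<^bsub>?M\<^esub> x = \<zero>\<^bsub>?M\<^esub>" if "x \<in> carrier ?M" for x
        using that by (intro bexI[of _ "- x"]) auto
    qed (auto simp: algebra_simps dest!: Poly_Mapping.keys_add[THEN subsetD])
    show "monoid ?M"
      by (rule monoidI) (use assoc unit monoid_algebra_mult_closed[OF assms] in auto)
  qed (simp_all add: monoid_algebra_distrib_left monoid_algebra_distrib_right)
qed

text \<open>Writing scalars as multiples of the unit makes scalar multiplication a ring product, so
  that it is compatible with residue classes.\<close>

lemma monoid_algebra_smult:
  assumes "monoid G" "Poly_Mapping.keys p \<subseteq> carrier G"
  shows "Poly_Mapping.map ((*) c) p = Poly_Mapping.single \<one>\<^bsub>G\<^esub> c \<otimes>\<^bsub>monoid_algebra G\<^esub> p"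
proof -
  interpret monoid G by fact
  have "Poly_Mapping.single \<one>\<^bsub>G\<^esub> c \<otimes>\<^bsub>monoid_algebra G\<^esub> p
      = (\<Sum>x\<in>Poly_Mapping.keys p. Poly_Mapping.single x (c * Poly_Mapping.lookup p x))"
    using assms(2) by (subst poly_mapping_sum_singles[of p])
      (auto simp: monoid_algebra_sum_mult monoid_algebra_mult_single intro!: sum.cong)
  also have "\<dots> = Poly_Mapping.map ((*) c) p"
    by (rule poly_mapping_eqI)
       (auto simp: lookup_sum lookup_single Poly_Mapping.map.rep_eq when_def not_in_keys_iff_lookup_eq_zero)
  finally show ?thesis ..
qed

text \<open>All ring operations agree with those of the factor ring, but the records have different
  types because the quotient algebra also carries scalars. The axioms are therefore carried over one
  by one.\<close>

lemma quotient_algebra_ring: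
  assumes "ideal I A"
  shows "ring (quotient_algebra A I)" "((+>\<^bsub>A\<^esub>) I) \<in> ring_hom A (quotient_algebra A I)"
proof -
  interpret ideal I A by fact
  have eq: "carrier (quotient_algebra A I) = carrier (A Quot I)"
    "mult (quotient_algebra A I) = mult (A Quot I)"
    "one (quotient_algebra A I) = one (A Quot I)" "zero (quotient_algebra A I) = zero (A Quot I)"
    "add (quotient_algebra A I) = add (A Quot I)"
    by (simp_all add: quotient_algebra_def FactRing_def)
  interpret Q: ring "A Quot I" by (rule quotient_is_ring)
  show "ring (quotient_algebra A I)"
  proof (rule ringI)
    show "abelian_group (quotient_algebra A I)"
    proof (rule abelian_groupI)
      show "\<exists>y\<in>carrier (quotient_algebra A I). y \<oplus>\<^bsub>quotient_algebra A I\<^esub> x = \<zero>\<^bsub>quotient_algebra A I\<^esub>"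
        if "x \<in> carrier (quotient_algebra A I)" for x
        using that Q.l_neg[of x] unfolding eq by blast
    qed (simp_all add: eq Q.a_ac)
    show "monoid (quotient_algebra A I)"
      by (rule monoidI) (auto simp: eq Q.m_assoc)
  qed (auto simp: eq Q.l_distr Q.r_distr)
  show "((+>\<^bsub>A\<^esub>) I) \<in> ring_hom A (quotient_algebra A I)"
    using rcos_ring_hom unfolding ring_hom_def eq .
qed

lemma quotient_algebra_carrier: "carrier (quotient_algebra A I) = (+>\<^bsub>A\<^esub>) I ` carrier A"
  by (auto simp: quotient_algebra_def A_RCOSETS_defs a_r_coset_def)

section \<open>Algebras given by generators and relations\<close>

locale algebra_presentation =
  fixes G :: "('a, 'm) monoid_scheme" and E :: "(('a \<Rightarrow>\<^sub>0 complex) \<times> ('a \<Rightarrow>\<^sub>0 complex)) set"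
  assumes monoid_G: "monoid G"
    and relations_carrier: "(x, y) \<in> E \<Longrightarrow> Poly_Mapping.keys x \<subseteq> carrier G \<and> Poly_Mapping.keys y \<subseteq> carrier G"
begin

abbreviation "cls \<equiv> residue_class G E"
abbreviation "P \<equiv> presented_algebra G E"

sublocale M: ring "monoid_algebra G" by (rule monoid_algebra_ring[OF monoid_G])

lemma uminus_monoid_algebra: "Poly_Mapping.keys x \<subseteq> carrier G \<Longrightarrow> \<ominus>\<^bsub>monoid_algebra G\<^esub> x = - x"
  by (rule M.minus_equality) auto

lemma ideal_relation_ideal: "ideal (relation_ideal G E) (monoid_algebra G)"
  unfolding relation_ideal_def
  by (rule M.genideal_ideal) (auto dest!: keys_diff[THEN subsetD] dest: relations_carrier)

interpretation I: ideal "relation_ideal G E" "monoid_algebra G"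
  by (rule ideal_relation_ideal)

sublocale P: ring P
  unfolding presented_algebra_def by (rule quotient_algebra_ring[OF ideal_relation_ideal])

lemma cls_hom: "cls \<in> ring_hom (monoid_algebra G) P"
  using quotient_algebra_ring(2)[OF ideal_relation_ideal]
  unfolding presented_algebra_def residue_class_def ring_hom_def by simp

lemma cls_closed [simp]: "Poly_Mapping.keys x \<subseteq> carrier G \<Longrightarrow> cls x \<in> carrier P"
  using cls_hom by (auto simp: ring_hom_def)

lemma cls_cases:
  assumes "a \<in> carrier P" obtains x where "Poly_Mapping.keys x \<subseteq> carrier G" "a = cls x"
  using assms unfolding presented_algebra_def quotient_algebra_carrier residue_class_def by auto

lemma cls_add: "Poly_Mapping.keys x \<subseteq> carrier G \<Longrightarrow> Poly_Mapping.keys y \<subseteq> carrier G \<Longrightarrow>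
    cls (x + y) = cls x \<oplus>\<^bsub>P\<^esub> cls y"
  using ring_hom_add[OF cls_hom, of x y] by simp

lemma cls_mult: "Poly_Mapping.keys x \<subseteq> carrier G \<Longrightarrow> Poly_Mapping.keys y \<subseteq> carrier G \<Longrightarrow>
    cls (x \<otimes>\<^bsub>monoid_algebra G\<^esub> y) = cls x \<otimes>\<^bsub>P\<^esub> cls y"
  using ring_hom_mult[OF cls_hom, of x y] by simp

lemma cls_one: "cls (Poly_Mapping.single \<one>\<^bsub>G\<^esub> 1) = \<one>\<^bsub>P\<^esub>"
  using ring_hom_one[OF cls_hom] by simp

lemma cls_minus:
  assumes "Poly_Mapping.keys x \<subseteq> carrier G" "Poly_Mapping.keys y \<subseteq> carrier G"
  shows "cls (x - y) = cls x \<ominus>\<^bsub>P\<^esub> cls y"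
proof -
  interpret h: ring_hom_ring "monoid_algebra G" P cls
    by (rule ring_hom_ring.intro[OF M.ring_axioms P.ring_axioms]) (simp add: ring_hom_ring_axioms_def cls_hom)
  have "cls (- y) = \<ominus>\<^bsub>P\<^esub> cls y" using h.hom_a_inv[of y] assms by (simp add: uminus_monoid_algebra)
  then show ?thesis using cls_add[of x "- y"] assms by (simp add: P.minus_eq)
qed

lemma cls_rel:
  assumes "(x, y) \<in> E"
  shows "cls x = cls y"
proof -
  have carr: "x \<in> carrier (monoid_algebra G)" "y \<in> carrier (monoid_algebra G)"
    using relations_carrier[OF assms] by simp_all
  have "x - y \<in> relation_ideal G E"
    unfolding relation_ideal_def using assms
    by (intro M.genideal_self[THEN subsetD]) (auto dest!: keys_diff[THEN subsetD] dest: relations_carrier)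
  then have "x \<ominus>\<^bsub>monoid_algebra G\<^esub> y \<in> relation_ideal G E"
    using carr by (simp add: M.minus_eq uminus_monoid_algebra)
  then show ?thesis unfolding residue_class_def
    using carr I.a_rcos_module_minus[OF M.ring_axioms carr(2) carr(1)] I.a_repr_independence'[of x y] by auto
qed

text \<open>The scalar multiple of a coset is defined as a union over its representatives. It is a
  single coset because multiplication by \<open>c\<close> times the unit takes all representatives
  of a class into one class. The closure keeps the bilinear relations of a tensor product inside the
  carrier of the product monoid.\<close>

lemma smult_closed:
  assumes "a \<in> carrier P"
  shows "c \<odot>\<^bsub>P\<^esub> a \<in> carrier P"
proof -
  obtain x where x: "Poly_Mapping.keys x \<subseteq> carrier G" "a = cls x" using assms by (rule cls_cases)
  let ?s = "\<lambda>x. Poly_Mapping.single \<one>\<^bsub>G\<^esub> c \<otimes>\<^bsub>monoid_algebra G\<^esub> x"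
  have s: "Poly_Mapping.keys (Poly_Mapping.single \<one>\<^bsub>G\<^esub> c) \<subseteq> carrier G"
    using monoid.one_closed[OF monoid_G] by auto
  have eq: "relation_ideal G E +>\<^bsub>monoid_algebra G\<^esub> (Poly_Mapping.map ((*) c) y) = cls (?s x)"
    if y: "y \<in> cls x" for y
  proof -
    have yc: "Poly_Mapping.keys y \<subseteq> carrier G"
      using y x(1) M.a_r_coset_subset_G[of "relation_ideal G E" x] I.a_subset
      unfolding residue_class_def by auto
    have "cls y = cls x"
      using y x(1) I.a_repr_independence'[of y x] unfolding residue_class_def by simp
    then have "cls (?s y) = cls (?s x)" using cls_mult[OF s yc] cls_mult[OF s x(1)] by simp
    then show ?thesis using yc by (simp add: monoid_algebra_smult[OF monoid_G] residue_class_def)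
  qed
  have "x \<in> cls x" unfolding residue_class_def using x(1) by (intro I.a_rcos_self) auto
  then have "c \<odot>\<^bsub>P\<^esub> a = cls (?s x)"
    using eq unfolding presented_algebra_def quotient_algebra_def x(2) by auto
  then show ?thesis using monoid_algebra_mult_closed[OF monoid_G s x(1)] by simp
qed

end

section \<open>Ordered products\<close>

context monoid
begin

definition oprod :: "(nat \<Rightarrow> 'a) \<Rightarrow> nat \<Rightarrow> nat \<Rightarrow> 'a" where
  "oprod f i j = ordered_prod G (map f [i..<j])"

lemma ordered_prod_closed: "set xs \<subseteq> carrier G \<Longrightarrow> ordered_prod G xs \<in> carrier G"
  by (induction xs) (auto simp: ordered_prod_def)

lemma ordered_prod_append: "set xs \<subseteq> carrier G \<Longrightarrow> set ys \<subseteq> carrier G \<Longrightarrow>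
    ordered_prod G (xs @ ys) = ordered_prod G xs \<otimes> ordered_prod G ys"
  using ordered_prod_closed[of ys]
  by (induction xs) (auto simp: ordered_prod_def m_assoc ordered_prod_closed[unfolded ordered_prod_def])

lemma oprod_closed [simp]: "(\<And>k. i \<le> k \<Longrightarrow> k < j \<Longrightarrow> f k \<in> carrier G) \<Longrightarrow> oprod f i j \<in> carrier G"
  unfolding oprod_def by (rule ordered_prod_closed) auto

lemma oprod_empty [simp]: "oprod f i i = \<one>"
  by (simp add: oprod_def ordered_prod_def)

lemma oprod_Suc: "i \<le> j \<Longrightarrow> (\<And>k. i \<le> k \<Longrightarrow> k \<le> j \<Longrightarrow> f k \<in> carrier G) \<Longrightarrow>
    oprod f i (Suc j) = oprod f i j \<otimes> f j"
  unfolding oprod_def by (simp, subst ordered_prod_append) (auto simp: ordered_prod_def)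

lemma oprod_head: "i < j \<Longrightarrow> oprod f i j = f i \<otimes> oprod f (Suc i) j"
  unfolding oprod_def by (simp add: upt_conv_Cons ordered_prod_def)

lemma oprod_split: "i \<le> k \<Longrightarrow> k \<le> j \<Longrightarrow> (\<And>l. i \<le> l \<Longrightarrow> l < j \<Longrightarrow> f l \<in> carrier G) \<Longrightarrow>
    oprod f i j = oprod f i k \<otimes> oprod f k j"
proof -
  assume ij: "i \<le> k" "k \<le> j" and c: "\<And>l. i \<le> l \<Longrightarrow> l < j \<Longrightarrow> f l \<in> carrier G"
  have "[i..<j] = [i..<k] @ [k..<j]" using upt_add_eq_append[of i k "j - k"] ij by simp
  then have "oprod f i j = ordered_prod G (map f [i..<k] @ map f [k..<j])"
    by (simp only: oprod_def map_append)
  also have "\<dots> = oprod f i k \<otimes> oprod f k j"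
    unfolding oprod_def using ij by (intro ordered_prod_append) (auto intro!: c)
  finally show ?thesis .
qed

lemma oprod_cong: "(\<And>k. i \<le> k \<Longrightarrow> k < j \<Longrightarrow> f k = g k) \<Longrightarrow> oprod f i j = oprod g i j"
  unfolding oprod_def by (intro arg_cong[of _ _ "ordered_prod G"] map_cong) auto

lemma commute_mult:
  assumes "x \<in> carrier G" "a \<in> carrier G" "b \<in> carrier G" "x \<otimes> a = a \<otimes> x" "x \<otimes> b = b \<otimes> x"
  shows "x \<otimes> (a \<otimes> b) = (a \<otimes> b) \<otimes> x"
proof -
  have "x \<otimes> (a \<otimes> b) = (a \<otimes> x) \<otimes> b" using assms by (simp only: m_assoc[symmetric])
  also have "\<dots> = (a \<otimes> b) \<otimes> x" using assms(1-3) by (simp add: m_assoc assms(5))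
  finally show ?thesis .
qed

lemma oprod_commute:
  assumes "x \<in> carrier G" "\<And>k. k < j \<Longrightarrow> f k \<in> carrier G" "\<And>k. k < j \<Longrightarrow> x \<otimes> f k = f k \<otimes> x"
  shows "x \<otimes> oprod f 0 j = oprod f 0 j \<otimes> x"
  using assms
proof (induction j)
  case (Suc j)
  then show ?case by (simp add: oprod_Suc commute_mult)
qed simp

end

section \<open>Dynamical determinants with arbitrary columns\<close>

text \<open>The relations in the form used for sorting columns. Indices are natural numbers, so that
  a word of columns has a numerical measure of disorder. \<open>ml_h_t\<close> and
  \<open>mr_h_t\<close> let a function of two indices pass a generator in a third row or column. In
  \<open>t_mr\<close> one \<open>f'\<close> serves all rows \<open>k\<close>, since a right function
  is shifted according to the column alone; this lets it leave a sum over permutations of the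
  rows.\<close>

locale dyn_matrix = ring R for R (structure) +
  fixes N :: nat and t :: "nat \<Rightarrow> nat \<Rightarrow> 'a" and ml mr :: "'f::comm_ring_1 \<Rightarrow> 'a"
    and h :: "nat \<Rightarrow> nat \<Rightarrow> 'f"
  assumes t_closed [simp]: "t i j \<in> carrier R"
    and ml_closed [simp]: "ml f \<in> carrier R" and mr_closed [simp]: "mr f \<in> carrier R"
    and ml_mult: "ml (f * f') = ml f \<otimes> ml f'" and mr_mult: "mr (f * f') = mr f \<otimes> mr f'"
    and mr_one: "mr 1 = \<one>"
    and ml_uminus: "ml (- f) = \<ominus> ml f" and mr_uminus: "mr (- f) = \<ominus> mr f"
    and ml_mr: "ml f \<otimes> mr f' = mr f' \<otimes> ml f"
    and ml_h_t: "i < N \<Longrightarrow> j < N \<Longrightarrow> k < N \<Longrightarrow> k \<noteq> i \<Longrightarrow> k \<noteq> j \<Longrightarrow> ml (h i j) \<otimes> t k l = t k l \<otimes> ml (h i j)"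
    and mr_h_t: "i < N \<Longrightarrow> j < N \<Longrightarrow> l < N \<Longrightarrow> l \<noteq> i \<Longrightarrow> l \<noteq> j \<Longrightarrow> mr (h i j) \<otimes> t k l = t k l \<otimes> mr (h i j)"
    and t_mr: "\<exists>f'. \<forall>k. t k l \<otimes> mr f = mr f' \<otimes> t k l"
    and column: "i < j \<Longrightarrow> j < N \<Longrightarrow> k < N \<Longrightarrow> ml (h j i) \<otimes> (t j k \<otimes> t i k) = t i k \<otimes> t j k"
    and comm: "i < j \<Longrightarrow> j < N \<Longrightarrow> k < l \<Longrightarrow> l < N \<Longrightarrow> t i k \<otimes> t j l =
       t j l \<otimes> t i k \<oplus> (ml (h j i) \<otimes> (t j k \<otimes> t i l) \<ominus> mr (h k l) \<otimes> (t j k \<otimes> t i l))"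
    and cross: "i < j \<Longrightarrow> j < N \<Longrightarrow> k < l \<Longrightarrow> l < N \<Longrightarrow> mr (h k l * h l k) \<otimes> (t j k \<otimes> t i l) =
       t i l \<otimes> t j k \<oplus> (mr (h l k) \<otimes> (t j l \<otimes> t i k) \<ominus> ml (h j i) \<otimes> (t j l \<otimes> t i k))"
begin

section \<open>Two-by-two minors and the exchange of their columns\<close>

text \<open>The columns \<open>k\<close> and \<open>l\<close> may come in either order and may
  coincide, as happens in an arbitrary word of columns.\<close>

definition minor2 :: "nat \<Rightarrow> nat \<Rightarrow> nat \<Rightarrow> nat \<Rightarrow> 'a" where
  "minor2 i j k l = t i k \<otimes> t j l \<ominus> ml (h j i) \<otimes> (t j k \<otimes> t i l)"

definition inversions :: "(nat \<Rightarrow> nat) \<Rightarrow> (nat \<times> nat) set" where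
  "inversions \<sigma> = {(k, l). k < l \<and> l < N \<and> \<sigma> k > \<sigma> l}"

definition S :: "(nat \<Rightarrow> nat) \<Rightarrow> 'f" where
  "S \<sigma> = (\<Prod>(k, l)\<in>inversions \<sigma>. - h (\<sigma> k) (\<sigma> l))"

definition D :: "(nat \<Rightarrow> nat) \<Rightarrow> 'a" where
  "D c = (\<Oplus>\<tau>\<in>{\<tau>. \<tau> permutes {..<N}}. ml (S \<tau>) \<otimes> oprod (\<lambda>k. t (\<tau> k) (c k)) 0 N)"

lemma minor2_closed [simp]: "minor2 i j k l \<in> carrier R"
  by (simp add: minor2_def)

lemma ml_commute: "ml f \<otimes> ml f' = ml f' \<otimes> ml f"
  by (metis ml_mult mult.commute)

lemma minor2_same: "i < j \<Longrightarrow> j < N \<Longrightarrow> k < N \<Longrightarrow> minor2 i j k k = \<zero>"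
  by (simp add: minor2_def column minus_eq r_neg)

text \<open>By \<open>comm\<close> the minor is \<open>?X\<close> minus \<open>mr (h k l)\<close>
  times \<open>?Y\<close>. After multiplication by \<open>mr (h l k)\<close> the second term is the
  left side of \<open>cross\<close>; substituting its right side cancels \<open>?X\<close> with
  coefficient \<open>mr (h l k)\<close>, and what remains is minus the minor with exchanged
  columns.\<close>

lemma minor2_exchange:
  assumes "i < j" "j < N" "k < l" "l < N"
  shows "minor2 i j l k = mr (- h l k) \<otimes> minor2 i j k l"
proof -
  let ?X = "t j l \<otimes> t i k" and ?Y = "t j k \<otimes> t i l" and ?Z = "t i l \<otimes> t j k"
  have alg: "x \<oplus> (u \<ominus> v) \<ominus> u = x \<ominus> v" if "x \<in> carrier R" "u \<in> carrier R" "v \<in> carrier R" for x u v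
    using that by algebra
  have "minor2 i j k l = ?X \<ominus> mr (h k l) \<otimes> ?Y"
    unfolding minor2_def comm[OF assms] by (rule alg) simp_all
  then have "mr (h l k) \<otimes> minor2 i j k l = mr (h l k) \<otimes> ?X \<ominus> mr (h k l * h l k) \<otimes> ?Y"
    by (simp add: minus_eq r_distr r_minus m_assoc mr_mult mult.commute[of "h k l"])
  also have "\<dots> = mr (h l k) \<otimes> ?X \<ominus> (?Z \<oplus> (mr (h l k) \<otimes> ?X \<ominus> ml (h j i) \<otimes> ?X))"
    unfolding cross[OF assms] ..
  also have "\<dots> = \<ominus> (?Z \<ominus> ml (h j i) \<otimes> ?X)"
  proof -
    have "u \<ominus> (z \<oplus> (u \<ominus> v)) = \<ominus> (z \<ominus> v)" if "z \<in> carrier R" "u \<in> carrier R" "v \<in> carrier R" for z u v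
      using that by algebra
    then show ?thesis by simp
  qed
  finally show ?thesis by (simp add: mr_uminus l_minus minor2_def)
qed

section \<open>Inversions and the coefficients \<open>S\<close>\<close>

lemma finite_inversions [simp]: "finite (inversions \<sigma>)"
  by (rule finite_subset[of _ "{..<N} \<times> {..<N}"]) (auto simp: inversions_def)

lemma S_id [simp]: "S id = 1"
proof -
  have "inversions id = {}" by (auto simp: inversions_def)
  then show ?thesis by (simp add: S_def)
qed

text \<open>Exchanging the positions \<open>m\<close> and \<open>Suc m\<close> carries the
  inversions of \<open>\<tau>\<close> injectively to inversions with the same pair of values, and
  exactly one inversion is new, namely \<open>(m, Suc m)\<close>. It contributes the extra
  factor.\<close>

lemma S_transpose:
  assumes "Suc m < N" "\<tau> m < \<tau> (Suc m)"
  shows "S (\<tau> \<circ> Transposition.transpose m (Suc m)) = - h (\<tau> (Suc m)) (\<tau> m) * S \<tau>"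
proof -
  let ?s = "Transposition.transpose m (Suc m)"
  let ?f = "\<lambda>(k, l). (?s k, ?s l)"
  have sub1: "?f p \<in> inversions (\<tau> \<circ> ?s)" if "p \<in> inversions \<tau>" for p
    using that assms by (cases p) (auto simp: inversions_def Transposition.transpose_def split: if_splits)
  have sub2: "p \<in> insert (m, Suc m) (?f ` inversions \<tau>)" if "p \<in> inversions (\<tau> \<circ> ?s)" for p
  proof (cases "p = (m, Suc m)")
    case False
    obtain k l where p: "p = (k, l)" by (cases p)
    have "?f p \<in> inversions \<tau>"
      using that assms False by (auto simp: p inversions_def Transposition.transpose_def split: if_splits)
    moreover have "p = ?f (?f p)" by (simp add: p)
    ultimately show ?thesis by blast
  qed simp
  have "(m, Suc m) \<in> inversions (\<tau> \<circ> ?s)" using assms by (simp add: inversions_def)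
  then have eq: "inversions (\<tau> \<circ> ?s) = insert (m, Suc m) (?f ` inversions \<tau>)"
    using sub1 sub2 by blast
  have notin: "(m, Suc m) \<notin> ?f ` inversions \<tau>"
    using assms by (auto simp: inversions_def Transposition.transpose_def split: if_splits)
  have inj: "inj_on ?f (inversions \<tau>)" by (rule inj_on_inverseI[of _ ?f]) auto
  show ?thesis
    unfolding S_def eq using notin
    by (simp add: prod.reindex[OF inj, unfolded case_prod_unfold] case_prod_unfold)
qed

section \<open>Grouping the summands of \<open>D\<close> in pairs\<close>

text \<open>The summands of \<open>\<tau>\<close> and \<open>\<tau> \<circ> s\<close> are added. By
  \<open>S_transpose\<close> the second one carries an extra \<open>- h\<close>, which passes
  \<open>X \<tau>\<close> by \<open>comm\<close> and reaches the two generators at \<open>m\<close>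
  and \<open>Suc m\<close>, where it completes a minor. The set \<open>Q\<close> and the surrounding
  factors \<open>X\<close>, \<open>Y\<close> are kept general to allow both repeated grouping at
  disjoint positions and grouping at a single one.\<close>

lemma transpose_pair_sum:
  fixes m
  defines "s \<equiv> Transposition.transpose m (Suc m)"
  assumes m: "Suc m < N" and fin: "finite Q"
    and perm: "\<And>\<tau>. \<tau> \<in> Q \<Longrightarrow> \<tau> permutes {..<N}" and Qs: "\<And>\<tau>. \<tau> \<in> Q \<Longrightarrow> \<tau> \<circ> s \<in> Q"
    and X: "\<And>\<tau>. X \<tau> \<in> carrier R" and Y: "\<And>\<tau>. Y \<tau> \<in> carrier R"
    and Xs: "\<And>\<tau>. \<tau> \<in> Q \<Longrightarrow> X (\<tau> \<circ> s) = X \<tau>" and Ys: "\<And>\<tau>. \<tau> \<in> Q \<Longrightarrow> Y (\<tau> \<circ> s) = Y \<tau>"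
    and comm: "\<And>\<tau>. \<tau> \<in> Q \<Longrightarrow>
      ml (h (\<tau> (Suc m)) (\<tau> m)) \<otimes> X \<tau> = X \<tau> \<otimes> ml (h (\<tau> (Suc m)) (\<tau> m))"
  shows "(\<Oplus>\<tau>\<in>Q. ml (S \<tau>) \<otimes> (X \<tau> \<otimes> ((t (\<tau> m) a \<otimes> t (\<tau> (Suc m)) b) \<otimes> Y \<tau>))) =
    (\<Oplus>\<tau>\<in>{\<tau>\<in>Q. \<tau> m < \<tau> (Suc m)}. ml (S \<tau>) \<otimes> (X \<tau> \<otimes> (minor2 (\<tau> m) (\<tau> (Suc m)) a b \<otimes> Y \<tau>)))"
proof -
  let ?F = "\<lambda>\<tau>. ml (S \<tau>) \<otimes> (X \<tau> \<otimes> ((t (\<tau> m) a \<otimes> t (\<tau> (Suc m)) b) \<otimes> Y \<tau>))"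
  let ?Q = "{\<tau>\<in>Q. \<tau> m < \<tau> (Suc m)}"
  have s2: "\<tau> \<circ> s \<circ> s = \<tau>" for \<tau> :: "nat \<Rightarrow> nat" by (rule ext) (simp add: s_def)
  have sm: "s m = Suc m" "s (Suc m) = m" by (simp_all add: s_def)
  have neq: "\<tau> m \<noteq> \<tau> (Suc m)" if "\<tau> \<in> Q" for \<tau>
    using inj_eq[OF permutes_inj[OF perm[OF that]]] by simp
  \<comment> \<open>Of \<open>\<tau>\<close> and \<open>\<tau> \<circ> s\<close> exactly one is
    increasing at \<open>m\<close>, so \<open>?Q\<close> contains one representative of each
    pair.\<close>
  have Q: "Q = ?Q \<union> (\<lambda>\<tau>. \<tau> \<circ> s) ` ?Q"
  proof (intro equalityI subsetI)
    fix \<tau> assume \<tau>: "\<tau> \<in> Q"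
    show "\<tau> \<in> ?Q \<union> (\<lambda>\<tau>. \<tau> \<circ> s) ` ?Q"
    proof (cases "\<tau> m < \<tau> (Suc m)")
      case False
      then have "\<tau> \<circ> s \<in> ?Q" using \<tau> Qs neq[OF \<tau>] by (simp add: sm)
      then show ?thesis by (intro UnI2 image_eqI[of _ _ "\<tau> \<circ> s"]) (simp_all only: s2)
    qed (use \<tau> in simp)
  qed (use Qs in auto)
  have disj: "?Q \<inter> (\<lambda>\<tau>. \<tau> \<circ> s) ` ?Q = {}" by (auto simp: sm)
  have inj: "inj_on (\<lambda>\<tau>. \<tau> \<circ> s) ?Q" by (rule inj_on_inverseI[of _ "\<lambda>\<tau>. \<tau> \<circ> s"]) (rule s2)
  have Fc: "?F \<tau> \<in> carrier R" for \<tau> using X Y by simp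
  have "(\<Oplus>\<tau>\<in>Q. ?F \<tau>) = (\<Oplus>\<tau>\<in>?Q. ?F \<tau>) \<oplus> (\<Oplus>\<tau>\<in>(\<lambda>\<tau>. \<tau> \<circ> s) ` ?Q. ?F \<tau>)"
    \<comment> \<open>The equation is instantiated at the whole sum: \<open>Q\<close> occurs in its
      own decomposition, so rewriting \<open>Q\<close> by itself would not terminate.\<close>
    unfolding arg_cong[OF Q, of "finsum R ?F"]
    by (rule finsum_Un_disjoint) (use fin disj Fc in auto)
  also have "(\<Oplus>\<tau>\<in>(\<lambda>\<tau>. \<tau> \<circ> s) ` ?Q. ?F \<tau>) = (\<Oplus>\<tau>\<in>?Q. ?F (\<tau> \<circ> s))"
    by (rule finsum_reindex) (use Fc inj in auto)
  also have "(\<Oplus>\<tau>\<in>?Q. ?F \<tau>) \<oplus> (\<Oplus>\<tau>\<in>?Q. ?F (\<tau> \<circ> s)) = (\<Oplus>\<tau>\<in>?Q. ?F \<tau> \<oplus> ?F (\<tau> \<circ> s))"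
    by (rule finsum_addf[symmetric]) (use X Y in auto)
  also have "\<dots> = (\<Oplus>\<tau>\<in>?Q. ml (S \<tau>) \<otimes> (X \<tau> \<otimes> (minor2 (\<tau> m) (\<tau> (Suc m)) a b \<otimes> Y \<tau>)))"
  proof (rule finsum_cong')
    fix \<tau> assume \<tau>: "\<tau> \<in> ?Q"
    let ?v = "t (\<tau> (Suc m)) a \<otimes> t (\<tau> m) b"
    let ?h = "h (\<tau> (Suc m)) (\<tau> m)"
    note [simp] = X[of \<tau>] Y[of \<tau>]
    have "?F (\<tau> \<circ> s) = ml (- ?h * S \<tau>) \<otimes> (X \<tau> \<otimes> (?v \<otimes> Y \<tau>))"
      using S_transpose[OF m, of \<tau>, folded s_def] \<tau> Xs Ys by (simp add: sm)
    also have "\<dots> = \<ominus> (ml (S \<tau>) \<otimes> ((ml ?h \<otimes> X \<tau>) \<otimes> (?v \<otimes> Y \<tau>)))"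
      by (simp add: mult.commute[of ?h] ml_mult ml_uminus m_assoc l_minus)
    also have "ml ?h \<otimes> X \<tau> = X \<tau> \<otimes> ml ?h" using comm \<tau> by simp
    also have "\<ominus> (ml (S \<tau>) \<otimes> ((X \<tau> \<otimes> ml ?h) \<otimes> (?v \<otimes> Y \<tau>))) = \<ominus> (ml (S \<tau>) \<otimes> (X \<tau> \<otimes> ((ml ?h \<otimes> ?v) \<otimes> Y \<tau>)))"
      by (simp add: m_assoc)
    finally have F: "?F (\<tau> \<circ> s) = \<dots>" .
    show "?F \<tau> \<oplus> ?F (\<tau> \<circ> s) = ml (S \<tau>) \<otimes> (X \<tau> \<otimes> (minor2 (\<tau> m) (\<tau> (Suc m)) a b \<otimes> Y \<tau>))"
      unfolding F by (simp add: minor2_def minus_eq l_distr r_distr l_minus r_minus)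
  qed (use X Y in auto)
  finally show ?thesis .
qed

lemma finite_perms [simp]: "finite {\<tau>. \<tau> permutes {..<N} \<and> P \<tau>}"
  by (rule finite_subset[OF _ finite_permutations[of "{..<N}"]]) auto

lemma permutes_transpose_Suc:
  "Suc m < N \<Longrightarrow> \<tau> permutes {..<N} \<Longrightarrow> \<tau> \<circ> Transposition.transpose m (Suc m) permutes {..<N}"
  by (intro permutes_compose permutes_swap_id) auto

text \<open>The generators of the minor lie in rows other than \<open>i\<close> and
  \<open>j\<close>, and its coefficient is a left function, which commutes with every left function.
  This carries \<open>h\<close> past the minors formed earlier when positions are grouped
  successively.\<close>

lemma ml_h_minor2:
  assumes "i < N" "j < N" "k < N" "l < N" "k \<noteq> i" "k \<noteq> j" "l \<noteq> i" "l \<noteq> j"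
  shows "ml (h i j) \<otimes> minor2 k l a b = minor2 k l a b \<otimes> ml (h i j)"
proof -
  have tt: "ml (h i j) \<otimes> (t x a \<otimes> t y b) = (t x a \<otimes> t y b) \<otimes> ml (h i j)"
    if "x \<in> {k, l}" "y \<in> {k, l}" for x y
    using that assms by (intro commute_mult ml_h_t) auto
  have "ml (h i j) \<otimes> (ml (h l k) \<otimes> (t l a \<otimes> t k b)) = (ml (h l k) \<otimes> (t l a \<otimes> t k b)) \<otimes> ml (h i j)"
    by (intro commute_mult ml_commute tt) simp_all
  then show ?thesis
    using tt[of k l] by (simp add: minor2_def minus_eq l_distr r_distr l_minus r_minus)
qed

text \<open>Induction on the number \<open>p\<close> of pairs of positions already grouped; the step
  groups the positions \<open>2 * p\<close> and \<open>2 * p + 1\<close>. For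
  \<open>2 * p = N\<close> no single generators are left and the permutations are those of the
  Pfaffian.\<close>

lemma D_eq_pairing_sum:
  assumes "2 * p \<le> N"
  shows "D c = (\<Oplus>\<tau>\<in>{\<tau>. \<tau> permutes {..<N} \<and> (\<forall>k<p. \<tau> (2 * k) < \<tau> (2 * k + 1))}.
     ml (S \<tau>) \<otimes> (oprod (\<lambda>k. minor2 (\<tau> (2 * k)) (\<tau> (2 * k + 1)) (c (2 * k)) (c (2 * k + 1))) 0 p
        \<otimes> oprod (\<lambda>k. t (\<tau> k) (c k)) (2 * p) N))"
  using assms
proof (induction p)
  case 0
  then show ?case by (simp add: D_def)
next
  case (Suc p)
  let ?X = "\<lambda>p \<tau>. oprod (\<lambda>k. minor2 (\<tau> (2 * k)) (\<tau> (2 * k + 1)) (c (2 * k)) (c (2 * k + 1))) 0 p"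
  let ?Y = "\<lambda>p \<tau>. oprod (\<lambda>k. t (\<tau> k) (c k)) (2 * p) N"
  let ?Q = "\<lambda>p. {\<tau>. \<tau> permutes {..<N} \<and> (\<forall>k<p. \<tau> (2 * k) < \<tau> (2 * k + 1))}"
  let ?s = "Transposition.transpose (2 * p) (Suc (2 * p))"
  have s: "?s k = k" if "k < 2 * p \<or> Suc (2 * p) < k" for k
    using that by (auto simp: Transposition.transpose_def)
  have "D c = (\<Oplus>\<tau>\<in>?Q p. ml (S \<tau>) \<otimes> (?X p \<tau> \<otimes> ?Y p \<tau>))" using Suc by simp
  also have "\<dots> = (\<Oplus>\<tau>\<in>?Q p. ml (S \<tau>) \<otimes> (?X p \<tau> \<otimes>
      ((t (\<tau> (2 * p)) (c (2 * p)) \<otimes> t (\<tau> (Suc (2 * p))) (c (Suc (2 * p)))) \<otimes> ?Y (Suc p) \<tau>)))"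
    using Suc.prems by (simp add: oprod_head m_assoc)
  also have "\<dots> = (\<Oplus>\<tau>\<in>{\<tau>\<in>?Q p. \<tau> (2 * p) < \<tau> (Suc (2 * p))}. ml (S \<tau>) \<otimes> (?X p \<tau> \<otimes>
      (minor2 (\<tau> (2 * p)) (\<tau> (Suc (2 * p))) (c (2 * p)) (c (Suc (2 * p))) \<otimes> ?Y (Suc p) \<tau>)))"
  proof (rule transpose_pair_sum)
    show "Suc (2 * p) < N" using Suc.prems by simp
    fix \<tau> assume \<tau>: "\<tau> \<in> ?Q p"
    then show "\<tau> permutes {..<N}" by simp
    show "\<tau> \<circ> ?s \<in> ?Q p"
      using \<tau> permutes_transpose_Suc[of "2 * p" \<tau>] Suc.prems by (auto simp: s)
    show "?X p (\<tau> \<circ> ?s) = ?X p \<tau>" by (rule oprod_cong) (simp add: s)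
    show "?Y (Suc p) (\<tau> \<circ> ?s) = ?Y (Suc p) \<tau>" by (rule oprod_cong) (simp add: s)
    have inj: "\<tau> x = \<tau> y \<longleftrightarrow> x = y" for x y using \<tau> by (auto simp: inj_eq permutes_inj)
    have lt: "\<tau> x < N \<longleftrightarrow> x < N" for x using \<tau> permutes_in_image[of \<tau> "{..<N}" x] by auto
    \<comment> \<open>The minors in \<open>?X p\<close> use the rows at positions below
      \<open>2 * p\<close>; since \<open>\<tau>\<close> is injective they differ from the two rows
      in \<open>h\<close>.\<close>
    show "ml (h (\<tau> (Suc (2 * p))) (\<tau> (2 * p))) \<otimes> ?X p \<tau> = ?X p \<tau> \<otimes> ml (h (\<tau> (Suc (2 * p))) (\<tau> (2 * p)))"
      using Suc.prems by (intro oprod_commute ml_h_minor2) (auto simp: inj lt)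
  qed simp_all
  also have "{\<tau>\<in>?Q p. \<tau> (2 * p) < \<tau> (Suc (2 * p))} = ?Q (Suc p)"
    by (auto simp: less_Suc_eq)
  also have "(\<Oplus>\<tau>\<in>?Q (Suc p). ml (S \<tau>) \<otimes> (?X p \<tau> \<otimes>
      (minor2 (\<tau> (2 * p)) (\<tau> (Suc (2 * p))) (c (2 * p)) (c (Suc (2 * p))) \<otimes> ?Y (Suc p) \<tau>)))
    = (\<Oplus>\<tau>\<in>?Q (Suc p). ml (S \<tau>) \<otimes> (?X (Suc p) \<tau> \<otimes> ?Y (Suc p) \<tau>))"
    by (simp add: oprod_Suc m_assoc)
  finally show ?case .
qed

text \<open>Grouping at the one position \<open>m\<close>, over all permutations. The generators
  before \<open>m\<close> lie in rows other than the two of the minor, so \<open>h\<close> passes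
  them.\<close>

lemma D_eq_minor_sum:
  assumes m: "Suc m < N"
  shows "D c = (\<Oplus>\<tau>\<in>{\<tau>. \<tau> permutes {..<N} \<and> \<tau> m < \<tau> (Suc m)}.
     ml (S \<tau>) \<otimes> (oprod (\<lambda>k. t (\<tau> k) (c k)) 0 m \<otimes>
       (minor2 (\<tau> m) (\<tau> (Suc m)) (c m) (c (Suc m)) \<otimes> oprod (\<lambda>k. t (\<tau> k) (c k)) (Suc (Suc m)) N)))"
proof -
  let ?s = "Transposition.transpose m (Suc m)"
  have s: "?s k = k" if "k < m \<or> Suc m < k" for k
    using that by (auto simp: Transposition.transpose_def)
  have "D c = (\<Oplus>\<tau>\<in>{\<tau>. \<tau> permutes {..<N}}.
     ml (S \<tau>) \<otimes> (oprod (\<lambda>k. t (\<tau> k) (c k)) 0 m \<otimes>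
       ((t (\<tau> m) (c m) \<otimes> t (\<tau> (Suc m)) (c (Suc m))) \<otimes> oprod (\<lambda>k. t (\<tau> k) (c k)) (Suc (Suc m)) N)))"
  proof -
    have "oprod f 0 N = oprod f 0 m \<otimes> ((f m \<otimes> f (Suc m)) \<otimes> oprod f (Suc (Suc m)) N)"
      if "\<And>k. f k \<in> carrier R" for f
      using m that oprod_split[of 0 m N f] by (simp add: oprod_head[of m] oprod_head[of "Suc m"] m_assoc)
    then show ?thesis unfolding D_def by simp
  qed
  also have "\<dots> = (\<Oplus>\<tau>\<in>{\<tau>\<in>{\<tau>. \<tau> permutes {..<N}}. \<tau> m < \<tau> (Suc m)}.
     ml (S \<tau>) \<otimes> (oprod (\<lambda>k. t (\<tau> k) (c k)) 0 m \<otimes>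
       (minor2 (\<tau> m) (\<tau> (Suc m)) (c m) (c (Suc m)) \<otimes> oprod (\<lambda>k. t (\<tau> k) (c k)) (Suc (Suc m)) N)))"
  proof (rule transpose_pair_sum[OF m])
    show "finite {\<tau>. \<tau> permutes {..<N}}" by (simp add: finite_permutations)
    fix \<tau> assume \<tau>: "\<tau> \<in> {\<tau>. \<tau> permutes {..<N}}"
    then show "\<tau> permutes {..<N}" by simp
    show "\<tau> \<circ> ?s \<in> {\<tau>. \<tau> permutes {..<N}}"
      using \<tau> permutes_transpose_Suc[OF m, of \<tau>] by auto
    show "oprod (\<lambda>k. t ((\<tau> \<circ> ?s) k) (c k)) 0 m = oprod (\<lambda>k. t (\<tau> k) (c k)) 0 m"
      by (rule oprod_cong) (simp add: s)
    show "oprod (\<lambda>k. t ((\<tau> \<circ> ?s) k) (c k)) (Suc (Suc m)) N = oprod (\<lambda>k. t (\<tau> k) (c k)) (Suc (Suc m)) N"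
      by (rule oprod_cong) (simp add: s)
    have inj: "\<tau> x = \<tau> y \<longleftrightarrow> x = y" for x y using \<tau> by (auto simp: inj_eq permutes_inj)
    have lt: "\<tau> x < N \<longleftrightarrow> x < N" for x using \<tau> permutes_in_image[of \<tau> "{..<N}" x] by auto
    show "ml (h (\<tau> (Suc m)) (\<tau> m)) \<otimes> oprod (\<lambda>k. t (\<tau> k) (c k)) 0 m
        = oprod (\<lambda>k. t (\<tau> k) (c k)) 0 m \<otimes> ml (h (\<tau> (Suc m)) (\<tau> m))"
      using m by (intro oprod_commute ml_h_t) (auto simp: inj lt)
  qed simp_all
  finally show ?thesis by simp
qed

section \<open>Sorting the columns of \<open>D\<close>\<close>

lemma D_closed [simp]: "D c \<in> carrier R"
  unfolding D_def by (rule finsum_closed) simp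

lemma D_cong:
  assumes "\<And>k. k < N \<Longrightarrow> c k = c' k"
  shows "D c = D c'"
proof -
  have "oprod (\<lambda>k. t (\<tau> k) (c k)) 0 N = oprod (\<lambda>k. t (\<tau> k) (c' k)) 0 N" for \<tau>
    using assms by (intro oprod_cong) simp
  then show ?thesis by (simp add: D_def)
qed

lemma D_adjacent_equal:
  assumes "Suc m < N" "c m = c (Suc m)" "c m < N"
  shows "D c = \<zero>"
proof -
  have "minor2 (\<tau> m) (\<tau> (Suc m)) (c m) (c (Suc m)) = \<zero>"
    if "\<tau> permutes {..<N}" "\<tau> m < \<tau> (Suc m)" for \<tau>
    using that assms permutes_in_image[of \<tau> "{..<N}" "Suc m"] by (simp add: minor2_same)
  then show ?thesis unfolding D_eq_minor_sum[OF assms(1)] by (intro add.finprod_one_eqI[simplified]) auto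
qed

text \<open>The exchange relation is applied in every summand of the sum of minors at
  \<open>m\<close>. The coefficient then stands behind the generators at earlier positions;
  \<open>move\<close> takes it to their left with one \<open>f\<close> for all
  \<open>\<tau>\<close>, and since it commutes with left functions it can be taken out of the sum.
  The choice of \<open>f\<close> stays open because a word with repetitions may shift the
  coefficient, while a permutation does not.\<close>

lemma D_transpose:
  assumes m: "Suc m < N" and desc: "c (Suc m) < c m" "c m < N"
    and move: "\<And>\<tau>. oprod (\<lambda>k. t (\<tau> k) (c k)) 0 m \<otimes> mr (- h (c m) (c (Suc m)))
       = mr f \<otimes> oprod (\<lambda>k. t (\<tau> k) (c k)) 0 m"
  shows "D c = mr f \<otimes> D (c \<circ> Transposition.transpose m (Suc m))"
proof -
  let ?c = "c \<circ> Transposition.transpose m (Suc m)"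
  let ?X = "\<lambda>c \<tau>. oprod (\<lambda>k. t (\<tau> k) (c k)) 0 m"
  let ?Y = "\<lambda>c \<tau>. oprod (\<lambda>k. t (\<tau> k) (c k)) (Suc (Suc m)) N"
  let ?M = "\<lambda>c \<tau>. minor2 (\<tau> m) (\<tau> (Suc m)) (c m) (c (Suc m))"
  let ?Q = "{\<tau>. \<tau> permutes {..<N} \<and> \<tau> m < \<tau> (Suc m)}"
  have s: "Transposition.transpose m (Suc m) k = k" if "k < m \<or> Suc m < k" for k
    using that by (auto simp: Transposition.transpose_def)
  have X: "?X ?c \<tau> = ?X c \<tau>" and Y: "?Y ?c \<tau> = ?Y c \<tau>" for \<tau>
    by (rule oprod_cong, simp add: s)+
  have "ml (S \<tau>) \<otimes> (?X c \<tau> \<otimes> (?M c \<tau> \<otimes> ?Y c \<tau>)) = mr f \<otimes> (ml (S \<tau>) \<otimes> (?X ?c \<tau> \<otimes> (?M ?c \<tau> \<otimes> ?Y ?c \<tau>)))"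
    if \<tau>: "\<tau> \<in> ?Q" for \<tau>
  proof -
    have "\<tau> (Suc m) < N" using \<tau> m permutes_in_image[of \<tau> "{..<N}" "Suc m"] by auto
    then have "?M c \<tau> = mr (- h (c m) (c (Suc m))) \<otimes> ?M ?c \<tau>"
      using \<tau> desc minor2_exchange[of "\<tau> m" "\<tau> (Suc m)" "c (Suc m)" "c m"] by simp
    then have "?X c \<tau> \<otimes> (?M c \<tau> \<otimes> ?Y c \<tau>) = (?X c \<tau> \<otimes> mr (- h (c m) (c (Suc m)))) \<otimes> (?M ?c \<tau> \<otimes> ?Y c \<tau>)"
      by (simp add: m_assoc)
    also have "\<dots> = mr f \<otimes> (?X c \<tau> \<otimes> (?M ?c \<tau> \<otimes> ?Y c \<tau>))"
      unfolding move by (simp add: m_assoc)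
    finally have "ml (S \<tau>) \<otimes> (?X c \<tau> \<otimes> (?M c \<tau> \<otimes> ?Y c \<tau>))
      = (ml (S \<tau>) \<otimes> mr f) \<otimes> (?X c \<tau> \<otimes> (?M ?c \<tau> \<otimes> ?Y c \<tau>))" by (simp add: m_assoc)
    then show ?thesis unfolding ml_mr X Y by (simp add: m_assoc)
  qed
  then have "D c = (\<Oplus>\<tau>\<in>?Q. mr f \<otimes> (ml (S \<tau>) \<otimes> (?X ?c \<tau> \<otimes> (?M ?c \<tau> \<otimes> ?Y ?c \<tau>))))"
    unfolding D_eq_minor_sum[OF m] by (intro finsum_cong') auto
  also have "\<dots> = mr f \<otimes> D ?c"
    unfolding D_eq_minor_sum[OF m] by (subst finsum_rdistr) auto
  finally show ?thesis .
qed

text \<open>The shift picked up at each generator depends on its column only, and the columns are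
  given by \<open>c\<close>. Hence \<open>f'\<close> does not depend on the rows
  \<open>\<tau>\<close>.\<close>

lemma oprod_mr: "\<exists>f'. \<forall>\<tau>. oprod (\<lambda>k. t (\<tau> k) (c k)) 0 m \<otimes> mr f = mr f' \<otimes> oprod (\<lambda>k. t (\<tau> k) (c k)) 0 m"
proof (induction m arbitrary: f)
  case 0
  then show ?case by auto
next
  case (Suc m)
  obtain g where g: "\<And>k. t k (c m) \<otimes> mr f = mr g \<otimes> t k (c m)" using t_mr[of "c m" f] by blast
  obtain g' where g': "\<And>\<tau>. oprod (\<lambda>k. t (\<tau> k) (c k)) 0 m \<otimes> mr g = mr g' \<otimes> oprod (\<lambda>k. t (\<tau> k) (c k)) 0 m"
    using Suc by blast
  have "oprod (\<lambda>k. t (\<tau> k) (c k)) 0 (Suc m) \<otimes> mr f = mr g' \<otimes> oprod (\<lambda>k. t (\<tau> k) (c k)) 0 (Suc m)" for \<tau>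
  proof -
    have "oprod (\<lambda>k. t (\<tau> k) (c k)) 0 (Suc m) \<otimes> mr f = (oprod (\<lambda>k. t (\<tau> k) (c k)) 0 m \<otimes> mr g) \<otimes> t (\<tau> m) (c m)"
      by (simp add: oprod_Suc m_assoc g)
    then show ?thesis by (simp add: g' oprod_Suc m_assoc)
  qed
  then show ?case by blast
qed

text \<open>The weight \<open>N - k\<close> is smaller by one at \<open>Suc m\<close> than at
  \<open>m\<close>, so moving the larger entry to the right lowers the sum by
  \<open>c m - c (Suc m)\<close>. This is the termination measure for sorting.\<close>

lemma descent_measure:
  fixes c :: "nat \<Rightarrow> nat"
  assumes m: "Suc m < N" and desc: "c (Suc m) < c m"
  shows "(\<Sum>k<N. (N - k) * (c \<circ> Transposition.transpose m (Suc m)) k) < (\<Sum>k<N. (N - k) * c k)"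
proof -
  have split: "(\<Sum>k<N. (N - k) * d k) = (\<Sum>k\<in>{..<N} - {m, Suc m}. (N - k) * d k)
     + ((N - m) * d m + (N - Suc m) * d (Suc m))" for d :: "nat \<Rightarrow> nat"
    using m by (subst sum.subset_diff[of "{m, Suc m}"]) auto
  obtain r where r: "N = Suc (Suc m) + r" using m by (metis Suc_leI le_Suc_ex)
  have "(\<Sum>k\<in>{..<N} - {m, Suc m}. (N - k) * (c \<circ> Transposition.transpose m (Suc m)) k) = (\<Sum>k\<in>{..<N} - {m, Suc m}. (N - k) * c k)"
    by (intro sum.cong) (auto simp: Transposition.transpose_def)
  then show ?thesis unfolding split using desc by (simp add: r algebra_simps)
qed

text \<open>Exchanging a strict descent expresses \<open>D c\<close> as a left multiple of
  \<open>D\<close> of a less disordered word, so vanishing is inherited from it and no coefficient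
  has to be inverted. The recursion ends at two equal adjacent entries.\<close>

lemma D_not_inj:
  assumes "c ` {..<N} \<subseteq> {..<N}" "\<not> inj_on c {..<N}"
  shows "D c = \<zero>"
  using assms
proof (induction "\<Sum>k<N. (N - k) * c k" arbitrary: c rule: less_induct)
  case less
  show ?case
  proof (cases "\<exists>m. Suc m < N \<and> c (Suc m) \<le> c m")
    case True
    then obtain m where m: "Suc m < N" "c (Suc m) \<le> c m" by blast
    have cm: "c m < N" using less.prems(1) m by (auto simp: image_subset_iff)
    show ?thesis
    proof (cases "c (Suc m) = c m")
      case True
      then show ?thesis using D_adjacent_equal[of m c] m cm by simp
    next
      case False
      let ?s = "Transposition.transpose m (Suc m)"
      have s: "?s permutes {..<N}" using m by (intro permutes_swap_id) auto
      obtain f where f: "\<And>\<tau>. oprod (\<lambda>k. t (\<tau> k) (c k)) 0 m \<otimes> mr (- h (c m) (c (Suc m)))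
         = mr f \<otimes> oprod (\<lambda>k. t (\<tau> k) (c k)) 0 m" using oprod_mr by blast
      have "D c = mr f \<otimes> D (c \<circ> ?s)" using D_transpose[OF m(1) _ cm f] m False by simp
      moreover have "D (c \<circ> ?s) = \<zero>"
      proof (rule less.hyps)
        show "(\<Sum>k<N. (N - k) * (c \<circ> ?s) k) < (\<Sum>k<N. (N - k) * c k)"
          using m False by (intro descent_measure) auto
        show "(c \<circ> ?s) ` {..<N} \<subseteq> {..<N}" unfolding image_comp[symmetric] permutes_image[OF s] by (rule less.prems(1))
        show "\<not> inj_on (c \<circ> ?s) {..<N}"
          using less.prems(2) permutes_image[OF s] inj_on_imageI[of c ?s "{..<N}"] by auto
      qed
      ultimately show ?thesis by simp
    qed
  next
    case False
    \<comment> \<open>Without a weak descent the word is strictly increasing, which contradicts the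
      repetition.\<close>
    have "c k < c l" if "k < l" "l < N" for k l
      using that
    proof (induction l)
      case (Suc l)
      then show ?case using False by (cases "k = l") (force simp: not_le)+
    qed simp
    then have "inj_on c {..<N}" by (auto simp: inj_on_def linorder_neq_iff) (metis nat_neq_iff)+
    then show ?thesis using less.prems by simp
  qed
qed

text \<open>The columns of a permutation are distinct, so the coefficient of an exchange passes the
  preceding generators unshifted. By \<open>S_transpose\<close> the coefficients collected while
  sorting multiply to \<open>S \<rho>\<close>.\<close>

lemma D_permutes:
  assumes "\<rho> permutes {..<N}"
  shows "D \<rho> = mr (S \<rho>) \<otimes> D id"
  using assms
proof (induction "\<Sum>k<N. (N - k) * \<rho> k" arbitrary: \<rho> rule: less_induct)
  case less
  have inj: "\<rho> x = \<rho> y \<longleftrightarrow> x = y" for x y using less.prems by (simp add: inj_eq permutes_inj)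
  have lt: "\<rho> x < N \<longleftrightarrow> x < N" for x using less.prems permutes_in_image[of \<rho> "{..<N}" x] by auto
  show ?case
  proof (cases "\<exists>m. Suc m < N \<and> \<rho> (Suc m) < \<rho> m")
    case True
    then obtain m where m: "Suc m < N" "\<rho> (Suc m) < \<rho> m" by blast
    let ?s = "Transposition.transpose m (Suc m)"
    have move: "oprod (\<lambda>k. t (\<tau> k) (\<rho> k)) 0 m \<otimes> mr (- h (\<rho> m) (\<rho> (Suc m)))
         = mr (- h (\<rho> m) (\<rho> (Suc m))) \<otimes> oprod (\<lambda>k. t (\<tau> k) (\<rho> k)) 0 m" for \<tau>
      using m
      by (intro oprod_commute[symmetric])
         (auto simp: mr_uminus l_minus r_minus inj lt intro!: arg_cong[of _ _ "a_inv R"] mr_h_t)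
    have "D \<rho> = mr (- h (\<rho> m) (\<rho> (Suc m))) \<otimes> D (\<rho> \<circ> ?s)"
      using m by (intro D_transpose move) (auto simp: lt)
    also have "D (\<rho> \<circ> ?s) = mr (S (\<rho> \<circ> ?s)) \<otimes> D id"
      using m less.prems by (intro less.hyps descent_measure permutes_transpose_Suc)
    also have "mr (- h (\<rho> m) (\<rho> (Suc m))) \<otimes> (mr (S (\<rho> \<circ> ?s)) \<otimes> D id) =
        mr (- h (\<rho> m) (\<rho> (Suc m)) * S (\<rho> \<circ> ?s)) \<otimes> D id"
      by (simp only: mr_mult m_assoc mr_closed D_closed)
    \<comment> \<open>\<open>S_transpose\<close> is applied to \<open>\<rho> \<circ> ?s\<close>,
      which is increasing at \<open>m\<close>; composing with \<open>?s\<close> again gives back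
      \<open>\<rho>\<close>.\<close>
    also have "- h (\<rho> m) (\<rho> (Suc m)) * S (\<rho> \<circ> ?s) = S \<rho>"
    proof -
      have "\<rho> \<circ> ?s \<circ> ?s = \<rho>" by (rule ext) simp
      then show ?thesis using S_transpose[of m "\<rho> \<circ> ?s"] m by simp
    qed
    finally show ?thesis .
  next
    case False
    \<comment> \<open>With no descent the values increase strictly from position to position, so
      \<open>\<rho> k\<close> is at least \<open>k\<close>; a permutation with this property is the
      identity.\<close>
    have le: "k \<le> \<rho> k" if "k < N" for k
      using that
    proof (induction k)
      case (Suc k)
      then have "\<not> \<rho> (Suc k) < \<rho> k" using False by blast
      then have "\<rho> k < \<rho> (Suc k)" using inj[of "Suc k" k] by simp
      then show ?case using Suc by simp
    qed simp
    then have "\<rho> = id" using permutes_natset_ge[OF less.prems] by simp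
    then show ?thesis by (simp add: mr_one)
  qed
qed

end

section \<open>Finite sums in a ring\<close>

context ring
begin

lemma finsum_product:
  assumes "finite A" "finite B" "\<And>a b. a \<in> A \<Longrightarrow> b \<in> B \<Longrightarrow> f a b \<in> carrier R"
  shows "(\<Oplus>a\<in>A. \<Oplus>b\<in>B. f a b) = finsum R (\<lambda>(a, b). f a b) (A \<times> B)"
  using assms(1,3)
proof (induction A)
  case (insert x A)
  have eq: "insert x A \<times> B = Pair x ` B \<union> A \<times> B" by auto
  have "finsum R (\<lambda>(a, b). f a b) (insert x A \<times> B) = finsum R (\<lambda>(a, b). f a b) (Pair x ` B) \<oplus> finsum R (\<lambda>(a, b). f a b) (A \<times> B)"
    unfolding eq using insert assms(2) by (intro finsum_Un_disjoint) auto
  also have "finsum R (\<lambda>(a, b). f a b) (Pair x ` B) = (\<Oplus>b\<in>B. f x b)"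
    using insert.prems by (subst finsum_reindex) (auto simp: inj_on_def)
  finally show ?case using insert assms(2) by (subst finsum_insert) (auto intro!: finsum_closed)
qed simp

lemma finsum_swap:
  assumes "finite A" "finite B" "\<And>a b. a \<in> A \<Longrightarrow> b \<in> B \<Longrightarrow> f a b \<in> carrier R"
  shows "(\<Oplus>a\<in>A. \<Oplus>b\<in>B. f a b) = (\<Oplus>b\<in>B. \<Oplus>a\<in>A. f a b)"
proof -
  have "(\<Oplus>a\<in>A. \<Oplus>b\<in>B. f a b) = finsum R (\<lambda>(a, b). f a b) (prod.swap ` (B \<times> A))"
    using assms by (simp add: finsum_product product_swap)
  also have "\<dots> = finsum R (\<lambda>(b, a). f a b) (B \<times> A)"
    using assms(3) by (subst finsum_reindex) (auto intro!: finsum_cong')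
  also have "\<dots> = (\<Oplus>b\<in>B. \<Oplus>a\<in>A. f a b)" using assms by (simp add: finsum_product)
  finally show ?thesis .
qed

text \<open>Expansion of a product of sums with the order of the factors preserved. The choices
  \<open>\<phi>\<close> are extensional functions, so each selection of summands is counted
  once.\<close>

lemma oprod_finsum:
  assumes "finite P" "\<And>k p. k < n \<Longrightarrow> p \<in> P \<Longrightarrow> F k p \<in> carrier R"
  shows "oprod (\<lambda>k. \<Oplus>p\<in>P. F k p) 0 n = (\<Oplus>\<phi>\<in>{..<n} \<rightarrow>\<^sub>E P. oprod (\<lambda>k. F k (\<phi> k)) 0 n)"
  using assms(2)
proof (induction n)
  case 0
  then show ?case by simp
next
  case (Suc n)
  let ?E = "{..<n} \<rightarrow>\<^sub>E P"
  have fin: "finite ?E" using assms(1) by (simp add: finite_PiE)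
  have c: "oprod (\<lambda>k. F k (\<phi> k)) 0 n \<in> carrier R" if "\<phi> \<in> ?E" for \<phi>
    using that Suc.prems by (intro oprod_closed) (auto simp: PiE_def Pi_def)
  have E: "{..<Suc n} \<rightarrow>\<^sub>E P = (\<lambda>(p, \<phi>). \<phi>(n := p)) ` (P \<times> ?E)"
    by (simp add: lessThan_Suc PiE_insert_eq)
  have inj: "inj_on (\<lambda>(p, \<phi>). \<phi>(n := p)) (P \<times> ?E)"
    using inj_combinator[of n "{..<n}" "\<lambda>_. P"] by simp
  have "oprod (\<lambda>k. \<Oplus>p\<in>P. F k p) 0 (Suc n) = (\<Oplus>\<phi>\<in>?E. oprod (\<lambda>k. F k (\<phi> k)) 0 n) \<otimes> (\<Oplus>p\<in>P. F n p)"
    using Suc by (subst oprod_Suc) (auto intro!: finsum_closed)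
  also have "\<dots> = (\<Oplus>\<phi>\<in>?E. \<Oplus>p\<in>P. oprod (\<lambda>k. F k (\<phi> k)) 0 n \<otimes> F n p)"
    using fin assms(1) Suc.prems c
    by (subst finsum_ldistr) (auto intro!: finsum_closed finsum_cong' finsum_rdistr)
  also have "\<dots> = finsum R (\<lambda>(p, \<phi>). oprod (\<lambda>k. F k (\<phi> k)) 0 n \<otimes> F n p) (P \<times> ?E)"
    using fin assms(1) Suc.prems c by (subst finsum_swap, simp_all) (intro finsum_product, simp_all)
  also have "\<dots> = (\<Oplus>x\<in>P \<times> ?E. oprod (\<lambda>k. F k ((case x of (p, \<phi>) \<Rightarrow> \<phi>(n := p)) k)) 0 (Suc n))"
  proof (rule finsum_cong')
    fix x assume "x \<in> P \<times> ?E"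
    then obtain \<phi> p where x: "x = (p, \<phi>)" "\<phi> \<in> ?E" "p \<in> P" by auto
    have "oprod (\<lambda>k. F k ((\<phi>(n := p)) k)) 0 (Suc n) = oprod (\<lambda>k. F k ((\<phi>(n := p)) k)) 0 n \<otimes> F n p"
      using x Suc.prems by (subst oprod_Suc) (auto simp: PiE_def Pi_def)
    also have "oprod (\<lambda>k. F k ((\<phi>(n := p)) k)) 0 n = oprod (\<lambda>k. F k (\<phi> k)) 0 n"
      by (rule oprod_cong) simp
    finally show "(case x of (p, \<phi>) \<Rightarrow> oprod (\<lambda>k. F k (\<phi> k)) 0 n \<otimes> F n p)
       = oprod (\<lambda>k. F k ((case x of (p, \<phi>) \<Rightarrow> \<phi>(n := p)) k)) 0 (Suc n)"
      by (simp add: x)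
  qed (use Suc.prems in \<open>auto intro!: oprod_closed simp: PiE_def Pi_def less_Suc_eq\<close>)
  also have "\<dots> = (\<Oplus>\<phi>\<in>{..<Suc n} \<rightarrow>\<^sub>E P. oprod (\<lambda>k. F k (\<phi> k)) 0 (Suc n))"
    unfolding E using inj
    by (subst finsum_reindex) (use Suc.prems in \<open>auto intro!: oprod_closed simp: PiE_def Pi_def less_Suc_eq\<close>)
  finally show ?case .
qed

text \<open>Stated for an additive subgroup because the balancing elements generate
  \<open>balancing\<close> only as an additive group.\<close>

lemma finsum_minus_mem:
  assumes "additive_subgroup K R" "finite A" "\<And>x. x \<in> A \<Longrightarrow> f x \<in> carrier R" "\<And>x. x \<in> A \<Longrightarrow> g x \<in> carrier R"
    "\<And>x. x \<in> A \<Longrightarrow> f x \<ominus> g x \<in> K"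
  shows "(\<Oplus>x\<in>A. f x) \<ominus> (\<Oplus>x\<in>A. g x) \<in> K"
  using assms(2-)
proof (induction A)
  case empty
  then show ?case using additive_subgroup.zero_closed[OF assms(1)] by (simp add: minus_eq)
next
  case (insert x A)
  have "(a \<oplus> b) \<ominus> (c \<oplus> d) = (a \<ominus> c) \<oplus> (b \<ominus> d)"
    if "a \<in> carrier R" "b \<in> carrier R" "c \<in> carrier R" "d \<in> carrier R" for a b c d
    using that by algebra
  then have "(\<Oplus>x\<in>insert x A. f x) \<ominus> (\<Oplus>x\<in>insert x A. g x) =
    (f x \<ominus> g x) \<oplus> ((\<Oplus>x\<in>A. f x) \<ominus> (\<Oplus>x\<in>A. g x))"
    using insert by (simp add: finsum_closed Pi_def)
  then show ?case using insert additive_subgroup.a_closed[OF assms(1)] by simp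
qed

end

section \<open>Tensor products\<close>

locale algebra_tensor = A: ring A + B: ring B
  for A :: "(complex, 'a) module" and B :: "(complex, 'b) module" +
  assumes smult_A: "a \<in> carrier A \<Longrightarrow> c \<odot>\<^bsub>A\<^esub> a \<in> carrier A"
    and smult_B: "b \<in> carrier B \<Longrightarrow> c \<odot>\<^bsub>B\<^esub> b \<in> carrier B"
begin

abbreviation "T \<equiv> tensor_algebra A B"

sublocale T: algebra_presentation "A \<times>\<times> B" "bilinear_relations A B"
  rewrites "presented_algebra (A \<times>\<times> B) (bilinear_relations A B) = tensor_algebra A B"
proof -
  show "algebra_presentation (A \<times>\<times> B) (bilinear_relations A B)"
  proof (rule algebra_presentation.intro)
    show "Group.monoid (A \<times>\<times> B)" by (rule DirProd_monoid) unfold_locales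
    fix x y assume "(x, y) \<in> bilinear_relations A B"
    then show "Poly_Mapping.keys x \<subseteq> carrier (A \<times>\<times> B) \<and> Poly_Mapping.keys y \<subseteq> carrier (A \<times>\<times> B)"
      by cases (auto simp: smult_A smult_B split: if_splits dest!: Poly_Mapping.keys_add[THEN subsetD])
  qed
qed (simp add: tensor_algebra_def)

lemma tensor_closed [simp]:
  "a \<in> carrier A \<Longrightarrow> b \<in> carrier B \<Longrightarrow> tensor A B a b \<in> carrier T"
  unfolding tensor_def by (rule T.cls_closed) auto

lemma tensor_add_left:
  assumes "a \<in> carrier A" "a' \<in> carrier A" "b \<in> carrier B"
  shows "tensor A B (a \<oplus>\<^bsub>A\<^esub> a') b = tensor A B a b \<oplus>\<^bsub>T\<^esub> tensor A B a' b"
  unfolding tensor_def using assms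
  by (subst T.cls_rel[OF bilinear_relations.add_left]) (auto intro!: T.cls_add)

lemma tensor_add_right:
  assumes "a \<in> carrier A" "b \<in> carrier B" "b' \<in> carrier B"
  shows "tensor A B a (b \<oplus>\<^bsub>B\<^esub> b') = tensor A B a b \<oplus>\<^bsub>T\<^esub> tensor A B a b'"
  unfolding tensor_def using assms
  by (subst T.cls_rel[OF bilinear_relations.add_right]) (auto intro!: T.cls_add)

lemma tensor_mult:
  assumes "a \<in> carrier A" "a' \<in> carrier A" "b \<in> carrier B" "b' \<in> carrier B"
  shows "tensor A B a b \<otimes>\<^bsub>T\<^esub> tensor A B a' b' = tensor A B (a \<otimes>\<^bsub>A\<^esub> a') (b \<otimes>\<^bsub>B\<^esub> b')"
  unfolding tensor_def using assms
  by (subst T.cls_mult[symmetric]) (auto simp: monoid_algebra_mult_single)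

lemma tensor_one: "tensor A B \<one>\<^bsub>A\<^esub> \<one>\<^bsub>B\<^esub> = \<one>\<^bsub>T\<^esub>"
  using T.cls_one by (simp add: tensor_def DirProd_def)

lemma tensor_zero_left: "b \<in> carrier B \<Longrightarrow> tensor A B \<zero>\<^bsub>A\<^esub> b = \<zero>\<^bsub>T\<^esub>"
  using tensor_add_left[of "\<zero>\<^bsub>A\<^esub>" "\<zero>\<^bsub>A\<^esub>" b] by simp

lemma tensor_zero_right: "a \<in> carrier A \<Longrightarrow> tensor A B a \<zero>\<^bsub>B\<^esub> = \<zero>\<^bsub>T\<^esub>"
  using tensor_add_right[of a "\<zero>\<^bsub>B\<^esub>" "\<zero>\<^bsub>B\<^esub>"] by simp

lemma tensor_finsum_left:
  assumes "finite I" "\<And>i. i \<in> I \<Longrightarrow> f i \<in> carrier A" "b \<in> carrier B"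
  shows "tensor A B (finsum A f I) b = finsum T (\<lambda>i. tensor A B (f i) b) I"
  using assms
  by (induction I) (simp_all add: tensor_zero_left tensor_add_left Pi_def A.finsum_closed)

lemma tensor_finsum_right:
  assumes "finite I" "a \<in> carrier A" "\<And>i. i \<in> I \<Longrightarrow> f i \<in> carrier B"
  shows "tensor A B a (finsum B f I) = finsum T (\<lambda>i. tensor A B a (f i)) I"
  using assms
  by (induction I) (simp_all add: tensor_zero_right tensor_add_right Pi_def B.finsum_closed)

lemma tensor_oprod:
  assumes "\<And>k. k < n \<Longrightarrow> f k \<in> carrier A" "\<And>k. k < n \<Longrightarrow> g k \<in> carrier B"
  shows "T.P.oprod (\<lambda>k. tensor A B (f k) (g k)) 0 n = tensor A B (A.oprod f 0 n) (B.oprod g 0 n)"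
  using assms
  by (induction n) (simp_all add: tensor_one T.P.oprod_Suc A.oprod_Suc B.oprod_Suc tensor_mult)

end

section \<open>Meromorphic functions\<close>

lemma mero_shift_mult: "mero_shift i (f * g) = mero_shift i f * mero_shift i g"
  by transfer (simp add: merom_eq_refl_iff merom_mult merom_translate)

lemma mero_shift_add: "mero_shift i (f + g) = mero_shift i f + mero_shift i g"
  by transfer (simp add: merom_eq_refl_iff merom_add merom_translate)

lemma mero_shift_uminus: "mero_shift i (- f) = - mero_shift i f"
  by transfer (simp add: merom_eq_refl_iff merom_uminus merom_translate)

lemma mero_shift_minus: "mero_shift i (f - g) = mero_shift i f - mero_shift i g"
  by (simp only: diff_conv_add_uminus mero_shift_add mero_shift_uminus)

lemma mero_shift_inverse: "mero_shift i (inverse f) = inverse (mero_shift i f)"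
  by transfer (simp add: merom_eq_refl_iff merom_inverse merom_translate)

lemma mero_shift_const: "mero_shift i (mero_const c) = mero_const c"
  by transfer (simp add: merom_eq_refl_iff merom_const)

lemma mero_const_1: "mero_const 1 = 1"
  by transfer (simp add: merom_eq_refl_iff merom_const)

lemma mero_shift_q_pow:
  assumes "k \<noteq> i" "k \<noteq> j"
  shows "mero_shift k (q_pow q i j) = q_pow q i j"
  using assms
proof transfer
  fix k i j :: 'a and q assume k: "k \<noteq> i" "k \<noteq> j"
  then have "(\<lambda>z::complex^'a. q powr (- 2 * ((z + axis k 1) $ i - (z + axis k 1) $ j))) =
      (\<lambda>z. q powr (- 2 * (z $ i - z $ j)))"
    by (intro ext) (simp add: axis_def)
  \<comment> \<open>The shifted representative is equal to the original one, so only its meromorphy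
    is left, and that is contained in the respectfulness theorem of \<open>q_pow\<close>.\<close>
  then show "merom_eq (\<lambda>z::complex^'a. q powr (- 2 * ((z + axis k 1) $ i - (z + axis k 1) $ j)))
      (\<lambda>z. q powr (- 2 * (z $ i - z $ j)))"
    by (simp only: q_pow.rsp[unfolded rel_fun_def, rule_format, OF refl refl refl])
qed

lemma mero_shift_dyn_h: "k \<noteq> i \<Longrightarrow> k \<noteq> j \<Longrightarrow> mero_shift k (dyn_h q i j) = dyn_h q i j"
  unfolding dyn_h_def divide_inverse
  by (simp add: mero_shift_mult mero_shift_minus mero_shift_inverse mero_shift_const mero_shift_q_pow
      flip: mero_const_1)

text \<open>The shift by minus the basis vector gives a preimage. The defining relations move a
  function to the right past a generator; with preimages it can also be moved to the left.\<close>

lemma mero_shift_surj: "\<exists>g. mero_shift i g = f"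
proof transfer
  fix i and f :: "complex^'a \<Rightarrow> complex" assume "merom_eq f f"
  then have f: "merom f" by (simp add: merom_eq_refl_iff)
  have "merom (\<lambda>z. f (z + - axis i 1))" using f by (rule merom_translate)
  then show "\<exists>g\<in>{g. merom_eq g g}. merom_eq (\<lambda>z. g (z + axis i 1)) f"
    using f by (intro bexI[of _ "\<lambda>z. f (z + - axis i 1)"]) (auto simp: merom_eq_refl_iff)
qed

section \<open>Dynamical quantum matrices\<close>

lemma monoid_free_monoid: "Group.monoid (free_monoid X)"
  by unfold_locales (auto simp: free_monoid_def)

interpretation FR: algebra_presentation "free_monoid UNIV" "fr_relations q"
  rewrites "presented_algebra (free_monoid UNIV) (fr_relations q) = FR q" for q
proof -
  show "algebra_presentation (free_monoid UNIV) (fr_relations q)"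
    by (rule algebra_presentation.intro[OF monoid_free_monoid]) (simp add: free_monoid_def)
qed (simp add: FR_def)

interpretation Balg: algebra_presentation
    "free_monoid (b_generators :: ('n::{finite,linorder}, 'n mero) b_gen set)" b_relations
  rewrites "presented_algebra (free_monoid (b_generators :: ('n, 'n mero) b_gen set)) b_relations = Balg"
proof -
  show "algebra_presentation (free_monoid (b_generators :: ('n, 'n mero) b_gen set)) b_relations"
  proof (rule algebra_presentation.intro[OF monoid_free_monoid])
    fix x y :: "('n, 'n mero) b_gen list \<Rightarrow>\<^sub>0 complex" assume "(x, y) \<in> b_relations"
    then show "Poly_Mapping.keys x \<subseteq> carrier (free_monoid b_generators) \<and> Poly_Mapping.keys y \<subseteq> carrier (free_monoid b_generators)"
      by cases (auto simp: free_monoid_def b_generators_def split: if_splits dest!: Poly_Mapping.keys_add[THEN subsetD])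
  qed
qed (simp add: Balg_def)

interpretation FB: algebra_tensor "FR q :: (complex, 'n::{finite,linorder} fr_elem) module" "Balg :: (complex, 'n b_elem) module"
  rewrites "tensor_algebra (FR q :: (complex, 'n fr_elem) module) (Balg :: (complex, 'n b_elem) module) = FB q"
    and "tensor (FR q :: (complex, 'n fr_elem) module) (Balg :: (complex, 'n b_elem) module) = fb_tensor q" for q
proof -
  show "algebra_tensor (FR q :: (complex, 'n fr_elem) module) (Balg :: (complex, 'n b_elem) module)"
    by (intro algebra_tensor.intro algebra_tensor_axioms.intro FR.P.ring_axioms Balg.P.ring_axioms
          FR.smult_closed Balg.smult_closed)
qed (simp_all add: FB_def fb_tensor_def)

section \<open>The defining relations as equations between the generators\<close>

text \<open>Restricted to words of length at least two, so that rewriting splits a word into single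
  generators and then stops.\<close>

lemma fr_cls_word_Cons:
  "FR.cls q (word (x # y # xs)) = FR.cls q (word [x]) \<otimes>\<^bsub>FR q\<^esub> FR.cls q (word (y # xs))"
  by (subst FR.cls_mult[symmetric]) (auto simp: monoid_algebra_mult_single free_monoid_def)

lemma fr_keys [simp]: "Poly_Mapping.keys x \<subseteq> carrier (free_monoid UNIV)"
  by (simp add: free_monoid_def)

lemma t_gen_closed [simp]: "t_gen q i j \<in> carrier (FR q)"
  and mu_l_closed [simp]: "mu_l q f \<in> carrier (FR q)"
  and mu_r_closed [simp]: "mu_r q f \<in> carrier (FR q)"
  unfolding t_gen_def mu_l_def mu_r_def by (intro FR.cls_closed fr_keys)+

lemmas fr_rel_simps = fr_cls_word_Cons FR.cls_add[OF fr_keys fr_keys] FR.cls_minus[OF fr_keys fr_keys]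
  t_gen_def[symmetric] mu_l_def[symmetric] mu_r_def[symmetric]

lemma mu_l_add: "mu_l q (f + f') = mu_l q f \<oplus>\<^bsub>FR q\<^esub> mu_l q f'"
  using FR.cls_rel[OF fr_relations.left_add] by (simp only: fr_rel_simps)

lemma mu_r_add: "mu_r q (f + f') = mu_r q f \<oplus>\<^bsub>FR q\<^esub> mu_r q f'"
  using FR.cls_rel[OF fr_relations.right_add] by (simp only: fr_rel_simps)

lemma mu_l_mult: "mu_l q (f * f') = mu_l q f \<otimes>\<^bsub>FR q\<^esub> mu_l q f'"
  using FR.cls_rel[OF fr_relations.left_mult] by (simp only: fr_rel_simps)

lemma mu_r_mult: "mu_r q (f * f') = mu_r q f \<otimes>\<^bsub>FR q\<^esub> mu_r q f'"
  using FR.cls_rel[OF fr_relations.right_mult] by (simp only: fr_rel_simps)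

lemma fr_cls_word_Nil: "FR.cls q (word []) = \<one>\<^bsub>FR q\<^esub>"
  using FR.cls_one[of q] unfolding free_monoid_def monoid.simps .

lemma mu_l_one: "mu_l q 1 = \<one>\<^bsub>FR q\<^esub>"
  unfolding mu_l_def mero_const_1[symmetric]
  by (rule FR.cls_rel[OF fr_relations.left_const, THEN trans, OF fr_cls_word_Nil])

lemma mu_r_one: "mu_r q 1 = \<one>\<^bsub>FR q\<^esub>"
  unfolding mu_r_def mero_const_1[symmetric]
  by (rule FR.cls_rel[OF fr_relations.right_const, THEN trans, OF fr_cls_word_Nil])

lemma mu_l_uminus: "mu_l q (- f) = \<ominus>\<^bsub>FR q\<^esub> mu_l q f"
proof -
  have "mu_l q 0 = \<zero>\<^bsub>FR q\<^esub>" using mu_l_add[of q 0 0] by simp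
  then show ?thesis
    using mu_l_add[of q "- f" f] by (intro FR.P.minus_equality[symmetric]) auto
qed

lemma mu_r_uminus: "mu_r q (- f) = \<ominus>\<^bsub>FR q\<^esub> mu_r q f"
proof -
  have "mu_r q 0 = \<zero>\<^bsub>FR q\<^esub>" using mu_r_add[of q 0 0] by simp
  then show ?thesis
    using mu_r_add[of q "- f" f] by (intro FR.P.minus_equality[symmetric]) auto
qed

lemma mu_l_mu_r: "mu_l q f \<otimes>\<^bsub>FR q\<^esub> mu_r q f' = mu_r q f' \<otimes>\<^bsub>FR q\<^esub> mu_l q f"
  using FR.cls_rel[OF fr_relations.left_right] by (simp only: fr_rel_simps)

lemma mu_l_t_gen: "mu_l q f \<otimes>\<^bsub>FR q\<^esub> t_gen q i j = t_gen q i j \<otimes>\<^bsub>FR q\<^esub> mu_l q (mero_shift i f)"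
  using FR.cls_rel[OF fr_relations.left_shift] by (simp only: fr_rel_simps)

lemma mu_r_t_gen: "mu_r q f \<otimes>\<^bsub>FR q\<^esub> t_gen q i j = t_gen q i j \<otimes>\<^bsub>FR q\<^esub> mu_r q (mero_shift j f)"
  using FR.cls_rel[OF fr_relations.right_shift] by (simp only: fr_rel_simps)

section \<open>The increasing enumeration of the index set\<close>

lemma sorted_wrt_nth_elem:
  fixes I :: "'n::{finite,linorder} set"
  assumes "i < card I" "j < card I"
  shows "nth_elem I i < nth_elem I j \<longleftrightarrow> i < j"
proof -
  have "nth_elem I i < nth_elem I j" if "i < j" "j < card I" for i j
    unfolding nth_elem_def using that
    by (intro sorted_wrt_nth_less[OF strict_sorted_list_of_set]) simp_all
  from this[of i j] this[of j i] show ?thesis using assms by (cases i j rule: linorder_cases) auto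
qed

lemma nth_elem_eq_iff:
  fixes I :: "'n::{finite,linorder} set"
  shows "i < card I \<Longrightarrow> j < card I \<Longrightarrow> nth_elem I i = nth_elem I j \<longleftrightarrow> i = j"
  unfolding nth_elem_def by (simp add: nth_eq_iff_index_eq)

lemma nth_elem_image: "nth_elem I ` {..<card I} = I" for I :: "'n::{finite,linorder} set"
proof -
  have "nth_elem I ` {..<card I} = set (sorted_list_of_set I)"
    unfolding set_conv_nth nth_elem_def by auto
  then show ?thesis by simp
qed

abbreviation "nth_UNIV \<equiv> nth_elem UNIV"

text \<open>The enumeration is increasing, so inequalities between natural numbers become the side
  conditions of the relations. A shift in a third coordinate fixes \<open>dyn_h\<close>, which gives
  the two commutation rules, and \<open>t_mr\<close> is the surjectivity of the shift in the column
  index.\<close>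

interpretation FR: dyn_matrix "FR q" "CARD('n)" "\<lambda>i j. t_gen q (nth_elem UNIV i) (nth_elem UNIV j)"
    "mu_l q" "mu_r q" "\<lambda>i j. dyn_h q (nth_elem UNIV i) (nth_elem UNIV j :: 'n::{finite,linorder})" for q
proof (intro dyn_matrix.intro dyn_matrix_axioms.intro FR.P.ring_axioms t_gen_closed mu_l_closed mu_r_closed
    mu_l_mult mu_r_mult mu_r_one mu_l_uminus mu_r_uminus mu_l_mu_r)
  let ?e = "nth_elem UNIV :: nat \<Rightarrow> 'n"
  note less = sorted_wrt_nth_elem[of _ "UNIV :: 'n set"] and eq = nth_elem_eq_iff[of _ "UNIV :: 'n set"]
  fix i j k l :: nat
  show "mu_l q (dyn_h q (?e i) (?e j)) \<otimes>\<^bsub>FR q\<^esub> t_gen q (?e k) (?e l) = t_gen q (?e k) (?e l) \<otimes>\<^bsub>FR q\<^esub> mu_l q (dyn_h q (?e i) (?e j))"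
    if "i < CARD('n)" "j < CARD('n)" "k < CARD('n)" "k \<noteq> i" "k \<noteq> j"
    using that by (simp add: mu_l_t_gen mero_shift_dyn_h eq)
  show "mu_r q (dyn_h q (?e i) (?e j)) \<otimes>\<^bsub>FR q\<^esub> t_gen q (?e k) (?e l) = t_gen q (?e k) (?e l) \<otimes>\<^bsub>FR q\<^esub> mu_r q (dyn_h q (?e i) (?e j))"
    if "i < CARD('n)" "j < CARD('n)" "l < CARD('n)" "l \<noteq> i" "l \<noteq> j"
    using that by (simp add: mu_r_t_gen mero_shift_dyn_h eq)
  show "\<exists>f'. \<forall>k. t_gen q (?e k) (?e l) \<otimes>\<^bsub>FR q\<^esub> mu_r q f = mu_r q f' \<otimes>\<^bsub>FR q\<^esub> t_gen q (?e k) (?e l)" for f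
    using mero_shift_surj[of "?e l" f] mu_r_t_gen by metis
  assume ij: "i < j" "j < CARD('n)"
  then have e1: "?e i < ?e j" by (simp add: less)
  show "mu_l q (dyn_h q (?e j) (?e i)) \<otimes>\<^bsub>FR q\<^esub> (t_gen q (?e j) (?e k) \<otimes>\<^bsub>FR q\<^esub> t_gen q (?e i) (?e k)) = t_gen q (?e i) (?e k) \<otimes>\<^bsub>FR q\<^esub> t_gen q (?e j) (?e k)"
    using FR.cls_rel[OF fr_relations.column[OF e1]] by (simp only: fr_rel_simps)
  assume kl: "k < l" "l < CARD('n)"
  then have e2: "?e k < ?e l" by (simp add: less)
  show "t_gen q (?e i) (?e k) \<otimes>\<^bsub>FR q\<^esub> t_gen q (?e j) (?e l) = t_gen q (?e j) (?e l) \<otimes>\<^bsub>FR q\<^esub> t_gen q (?e i) (?e k) \<oplus>\<^bsub>FR q\<^esub>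
     (mu_l q (dyn_h q (?e j) (?e i)) \<otimes>\<^bsub>FR q\<^esub> (t_gen q (?e j) (?e k) \<otimes>\<^bsub>FR q\<^esub> t_gen q (?e i) (?e l)) \<ominus>\<^bsub>FR q\<^esub>
      mu_r q (dyn_h q (?e k) (?e l)) \<otimes>\<^bsub>FR q\<^esub> (t_gen q (?e j) (?e k) \<otimes>\<^bsub>FR q\<^esub> t_gen q (?e i) (?e l)))"
    using FR.cls_rel[OF fr_relations.comm[OF e1 e2]] by (simp only: fr_rel_simps)
  show "mu_r q (dyn_h q (?e k) (?e l) * dyn_h q (?e l) (?e k)) \<otimes>\<^bsub>FR q\<^esub> (t_gen q (?e j) (?e k) \<otimes>\<^bsub>FR q\<^esub> t_gen q (?e i) (?e l)) =
     t_gen q (?e i) (?e l) \<otimes>\<^bsub>FR q\<^esub> t_gen q (?e j) (?e k) \<oplus>\<^bsub>FR q\<^esub>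
     (mu_r q (dyn_h q (?e l) (?e k)) \<otimes>\<^bsub>FR q\<^esub> (t_gen q (?e j) (?e l) \<otimes>\<^bsub>FR q\<^esub> t_gen q (?e i) (?e k)) \<ominus>\<^bsub>FR q\<^esub>
      mu_l q (dyn_h q (?e j) (?e i)) \<otimes>\<^bsub>FR q\<^esub> (t_gen q (?e j) (?e l) \<otimes>\<^bsub>FR q\<^esub> t_gen q (?e i) (?e k)))"
    using FR.cls_rel[OF fr_relations.cross[OF e1 e2, unfolded dyn_g_def]] by (simp only: fr_rel_simps)
qed

lemma dyn_S_eq: "dyn_S q \<sigma> (UNIV :: 'n::{finite,linorder} set) = FR.S q \<sigma>"
  by (simp add: dyn_S_def FR.S_def FR.inversions_def)

section \<open>Pfaffians\<close>

lemma dyn_det_eq: "dyn_det q = (FR.D q id :: 'n::{finite,linorder} fr_elem)"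
proof -
  have "dyn_S q id (UNIV :: 'n set) = 1" by (simp add: dyn_S_eq)
  then show ?thesis
    unfolding dyn_det_def dyn_minor_def minor_wrt_def FR.D_def FR.P.oprod_def
    by (simp add: mu_r_one dyn_S_eq FR.P.ordered_prod_closed FR.P.finsum_closed image_subset_iff Pi_def)
qed

lemma nth_elem_pair:
  assumes "a < (b :: 'n::{finite,linorder})"
  shows "nth_elem {a, b} 0 = a" "nth_elem {a, b} (Suc 0) = b"
proof -
  have "sorted_list_of_set {a, b} = [a, b]"
    using assms by (intro sorted_list_of_set_unique[THEN iffD1]) auto
  then show "nth_elem {a, b} 0 = a" "nth_elem {a, b} (Suc 0) = b"
    by (simp_all add: nth_elem_def)
qed

text \<open>The two permutations of two positions give the two terms. The transposition has the
  single inversion \<open>(0, 1)\<close>, whose factor is \<open>- h\<close> at the larger and the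
  smaller row, in this order.\<close>

lemma dyn_minor_pair:
  fixes i j k l :: nat
  assumes "i < j" "j < CARD('n)" "k < l" "l < CARD('n)"
  shows "dyn_minor q {nth_UNIV i, nth_UNIV j} {nth_UNIV k, nth_UNIV l :: 'n::{finite,linorder}} = FR.minor2 q i j k l"
proof -
  let ?e = "nth_UNIV :: nat \<Rightarrow> 'n" and ?s = "Transposition.transpose 0 (Suc 0)"
  have less: "?e i < ?e j" "?e k < ?e l"
    using assms by (simp_all add: sorted_wrt_nth_elem)
  note nth = nth_elem_pair[OF less(1)] nth_elem_pair[OF less(2)]
  have card: "card {?e i, ?e j} = Suc (Suc 0)" "card {?e k, ?e l} = Suc (Suc 0)" using less by auto
  have perms: "{\<sigma>. \<sigma> permutes {..<Suc (Suc 0)}} = {id, ?s}"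
  proof -
    have "{..<Suc (Suc 0)} = {0, Suc 0}" by auto
    then show ?thesis by (simp only: permutes_doubleton_iff) auto
  qed
  have ne: "id \<noteq> ?s" by (metis id_apply n_not_Suc_n transpose_apply_first)
  have "{(k, l). k < l \<and> l < card I \<and> id k > id l} = {}" for I :: "'n set" by auto
  then have S_id: "dyn_S q id I = 1" for I :: "'n set" unfolding dyn_S_def by (simp only: prod.empty)
  have "{(k, l). k < l \<and> l < Suc (Suc 0) \<and> ?s k > ?s l} = {(0, Suc 0)}"
    by (auto simp: less_Suc_eq)
  then have S_s: "dyn_S q ?s {?e i, ?e j} = - dyn_h q (?e j) (?e i)"
    unfolding dyn_S_def card by (simp add: nth)
  show ?thesis
    unfolding dyn_minor_def minor_wrt_def S_id card perms FR.minor2_def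
    using ne
    by (simp add: S_id S_s mu_r_one mu_l_one mu_l_uminus ordered_prod_def upt_rec nth FR.P.l_minus FR.P.minus_eq)
qed

definition pairs :: "nat \<Rightarrow> (nat \<times> nat) set" where
  "pairs N = {(k, l). k < l \<and> l < N}"

lemma finite_pairs [simp]: "finite (pairs N)"
  by (rule finite_subset[of _ "{..<N} \<times> {..<N}"]) (auto simp: pairs_def)

lemma b_elt_closed [simp]: "i < j \<Longrightarrow> b_elt i j \<in> carrier Balg"
  unfolding b_elt_def by (rule Balg.cls_closed) (auto simp: free_monoid_def b_generators_def)

lemma b_fun_closed [simp]: "b_fun f \<in> carrier Balg"
  unfolding b_fun_def by (rule Balg.cls_closed) (auto simp: free_monoid_def b_generators_def)

lemma b_elt_pair_closed:
  assumes "p \<in> pairs CARD('n::{finite,linorder})"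
  shows "b_elt (nth_UNIV (fst p)) (nth_UNIV (snd p) :: 'n) \<in> carrier Balg"
  using assms by (intro b_elt_closed) (auto simp: pairs_def sorted_wrt_nth_elem)

lemma c_elt_eq:
  fixes i j :: nat
  assumes "i < j" "j < CARD('n)"
  shows "c_elt q (nth_UNIV i) (nth_UNIV j :: 'n::{finite,linorder}) =
    finsum (FB q) (\<lambda>(k, l). fb_tensor q (FR.minor2 q i j k l) (b_elt (nth_UNIV k) (nth_UNIV l))) (pairs CARD('n))"
proof -
  let ?e = "nth_UNIV :: nat \<Rightarrow> 'n"
  note less = sorted_wrt_nth_elem[of _ "UNIV :: 'n set"] and eq = nth_elem_eq_iff[of _ "UNIV :: 'n set"]
  let ?f = "\<lambda>(k, l). (?e k, ?e l)"
  have img: "{(k, l). k < l} = ?f ` pairs CARD('n)"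
  proof (intro equalityI subsetI)
    fix p :: "'n \<times> 'n" assume p: "p \<in> {(k, l). k < l}"
    obtain k l where kl: "p = (?e k, ?e l)" "k < CARD('n)" "l < CARD('n)"
      using nth_elem_image[of "UNIV :: 'n set"] by (metis UNIV_I imageE lessThan_iff surj_pair)
    then have "(k, l) \<in> pairs CARD('n)" using p by (simp add: pairs_def less)
    then show "p \<in> ?f ` pairs CARD('n)" using kl by force
  qed (auto simp: pairs_def less)
  have inj: "inj_on ?f (pairs CARD('n))" by (auto simp: inj_on_def pairs_def eq)
  have mem: "FR.minor2 q i j k l = dyn_minor q {?e i, ?e j} {?e k, ?e l}" "?e k < ?e l" if "(k, l) \<in> pairs CARD('n)" for k l
    using that assms by (auto simp: dyn_minor_pair less pairs_def)
  have "c_elt q (?e i) (?e j) = finsum (FB q) (\<lambda>p. (\<lambda>(k, l). fb_tensor q (dyn_minor q {?e i, ?e j} {k, l}) (b_elt k l)) (?f p)) (pairs CARD('n))"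
    unfolding c_elt_def img
    by (rule FB.T.P.finsum_reindex[OF _ inj]) (auto simp: mem(1)[symmetric] intro!: FB.tensor_closed FR.minor2_closed b_elt_closed mem(2))
  also have "\<dots> = finsum (FB q) (\<lambda>(k, l). fb_tensor q (FR.minor2 q i j k l) (b_elt (nth_UNIV k) (nth_UNIV l))) (pairs CARD('n))"
    by (rule FB.T.P.finsum_cong') (auto simp: mem(1)[symmetric] intro!: FB.tensor_closed FR.minor2_closed b_elt_closed mem(2))
  finally show ?thesis .
qed

text \<open>The word of columns belonging to the monomial in the \<open>b\<close> whose index pairs
  are chosen by \<open>\<phi>\<close>.\<close>

definition column_word :: "(nat \<Rightarrow> nat \<times> nat) \<Rightarrow> nat \<Rightarrow> nat" where
  "column_word \<phi> k = (if even k then fst (\<phi> (k div 2)) else snd (\<phi> (k div 2)))"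

lemma column_word_simps [simp]: "column_word \<phi> (2 * k) = fst (\<phi> k)" "column_word \<phi> (Suc (2 * k)) = snd (\<phi> k)"
  by (simp_all add: column_word_def)

section \<open>Pairing permutations as choices of column pairs\<close>

text \<open>The inverse of flattening a choice to a word; restricted to \<open>{..<n}\<close> so
  that it is an extensional choice function, as in the expansion of a product of sums.\<close>

definition pair_choice :: "nat \<Rightarrow> (nat \<Rightarrow> nat) \<Rightarrow> nat \<Rightarrow> nat \<times> nat" where
  "pair_choice n \<rho> = (\<lambda>k\<in>{..<n}. (\<rho> (2 * k), \<rho> (2 * k + 1)))"

lemma column_word_pair_choice: "k < 2 * n \<Longrightarrow> column_word (pair_choice n \<rho>) k = \<rho> k"
  by (auto simp: column_word_def pair_choice_def elim!: evenE oddE)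

lemma column_word_less:
  assumes "\<phi> \<in> {..<n} \<rightarrow>\<^sub>E pairs N" "k < 2 * n"
  shows "column_word \<phi> k < N"
proof -
  have "\<phi> (k div 2) \<in> pairs N" using assms by (intro PiE_mem[OF assms(1)]) auto
  then show ?thesis by (auto simp: column_word_def pairs_def)
qed

text \<open>Flattening recovers a permutation from its pairs. Conversely, an injective column word
  is an injective self-map of a finite set and hence a permutation, and it is a pairing permutation
  because each chosen pair is increasing.\<close>

lemma pairing_perms_bij:
  "bij_betw (pair_choice n) (pairing_perms n)
     {\<phi> \<in> {..<n} \<rightarrow>\<^sub>E pairs (2 * n). inj_on (column_word \<phi>) {..<2 * n}}"
proof (rule bij_betwI')
  fix \<rho> \<rho>' assume \<rho>: "\<rho> \<in> pairing_perms n" "\<rho>' \<in> pairing_perms n"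
  show "pair_choice n \<rho> = pair_choice n \<rho>' \<longleftrightarrow> \<rho> = \<rho>'"
  proof
    assume eq: "pair_choice n \<rho> = pair_choice n \<rho>'"
    show "\<rho> = \<rho>'"
    proof
      fix k
      show "\<rho> k = \<rho>' k"
      proof (cases "k < 2 * n")
        case True
        then show ?thesis using column_word_pair_choice eq by metis
      next
        case False
        then show ?thesis using \<rho> by (simp add: pairing_perms_def permutes_def)
      qed
    qed
  qed simp
next
  fix \<rho> assume \<rho>: "\<rho> \<in> pairing_perms n"
  then have p: "\<rho> permutes {..<2 * n}" and lt: "\<And>k. k < n \<Longrightarrow> \<rho> (2 * k) < \<rho> (2 * k + 1)"
    by (auto simp: pairing_perms_def)
  have "\<rho> (2 * k + 1) < 2 * n" if "k < n" for k using that permutes_in_image[OF p, of "2 * k + 1"] by simp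
  then have "pair_choice n \<rho> \<in> {..<n} \<rightarrow>\<^sub>E pairs (2 * n)"
    using lt by (auto simp: pair_choice_def pairs_def)
  moreover have "inj_on (column_word (pair_choice n \<rho>)) {..<2 * n}"
    using permutes_inj_on[OF p] by (rule inj_on_cong[THEN iffD1, rotated]) (simp add: column_word_pair_choice)
  ultimately show "pair_choice n \<rho> \<in> {\<phi> \<in> {..<n} \<rightarrow>\<^sub>E pairs (2 * n). inj_on (column_word \<phi>) {..<2 * n}}" by simp
next
  fix \<phi> assume "\<phi> \<in> {\<phi> \<in> {..<n} \<rightarrow>\<^sub>E pairs (2 * n). inj_on (column_word \<phi>) {..<2 * n}}"
  then have \<phi>: "\<phi> \<in> {..<n} \<rightarrow>\<^sub>E pairs (2 * n)" and inj: "inj_on (column_word \<phi>) {..<2 * n}" by auto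
  \<comment> \<open>\<open>permutes\<close> demands the identity outside the first
    \<open>2 * n\<close> positions, so the column word is replaced by it there.\<close>
  define \<rho> where "\<rho> k = (if k < 2 * n then column_word \<phi> k else k)" for k
  have "inj_on \<rho> {..<2 * n}"
    using inj by (rule inj_on_cong[THEN iffD1, rotated]) (simp add: \<rho>_def)
  moreover have "\<rho> ` {..<2 * n} \<subseteq> {..<2 * n}" using column_word_less[OF \<phi>] by (auto simp: \<rho>_def)
  ultimately have "bij_betw \<rho> {..<2 * n} {..<2 * n}"
    by (simp add: bij_betw_def endo_inj_surj)
  then have "\<rho> permutes {..<2 * n}" by (rule bij_imp_permutes) (simp add: \<rho>_def)
  moreover have "\<rho> (2 * k) < \<rho> (2 * k + 1)" if "k < n" for k
    using PiE_mem[OF \<phi>, of k] that by (auto simp: \<rho>_def pairs_def)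
  ultimately have "\<rho> \<in> pairing_perms n" by (simp add: pairing_perms_def)
  moreover have "\<phi> = pair_choice n \<rho>"
  proof
    fix k show "\<phi> k = pair_choice n \<rho> k"
      \<comment> \<open>For \<open>k\<close> outside \<open>{..<n}\<close> both sides have the
        default value of extensional functions.\<close>
      using PiE_arb[OF \<phi>, of k] by (auto simp: pair_choice_def \<rho>_def)
  qed
  ultimately show "\<exists>\<rho>\<in>pairing_perms n. \<phi> = pair_choice n \<rho>" by blast
qed

lemma finite_pairing_perms [simp]: "finite (pairing_perms n)"
  unfolding pairing_perms_def by (rule finite_subset[OF _ finite_permutations[of "{..<2 * n}"]]) auto

section \<open>The balancing subgroup\<close>

lemma balancing_additive_subgroup: "additive_subgroup (balancing q) (FB q)"
proof -
  have "subgroup (balancing q) (add_monoid (FB q))"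
    unfolding balancing_def
  proof (rule group.generate_is_subgroup[OF FB.T.P.a_group])
    show "{fb_tensor q (mu_r q f \<otimes>\<^bsub>FR q\<^esub> t) b \<ominus>\<^bsub>FB q\<^esub> fb_tensor q t (b_fun f \<otimes>\<^bsub>Balg\<^esub> b) |f t b.
        t \<in> carrier (FR q) \<and> b \<in> carrier Balg} \<subseteq> carrier (add_monoid (FB q))"
      by (auto intro!: FB.T.P.minus_closed FB.tensor_closed FR.P.m_closed Balg.P.m_closed)
  qed
  then show ?thesis by (rule additive_subgroup.intro)
qed

lemma balancing_mem:
  "t \<in> carrier (FR q) \<Longrightarrow> b \<in> carrier Balg \<Longrightarrow>
    fb_tensor q (mu_r q f \<otimes>\<^bsub>FR q\<^esub> t) b \<ominus>\<^bsub>FB q\<^esub> fb_tensor q t (b_fun f \<otimes>\<^bsub>Balg\<^esub> b) \<in> balancing q"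
  unfolding balancing_def by (rule generate.incl) blast

lemma dyn_class_eqI:
  assumes "x \<in> carrier (FB q)" "y \<in> carrier (FB q)" "x \<ominus>\<^bsub>FB q\<^esub> y \<in> balancing q"
  shows "dyn_class q x = dyn_class q y"
proof -
  interpret K: abelian_subgroup "balancing q" "FB q"
    by (rule abelian_subgroupI3[OF balancing_additive_subgroup FB.T.P.is_abelian_group])
  have "x \<in> balancing q +>\<^bsub>FB q\<^esub> y"
    using K.a_rcos_module_minus[OF FB.T.P.ring_axioms assms(2,1)] assms(3) by simp
  then show ?thesis unfolding dyn_class_def using K.a_repr_independence'[OF _ assms(2)] by simp
qed

lemma fb_fun_closed [simp]: "fb_fun q f \<in> carrier (FB q)"
  by (simp add: fb_fun_def)

section \<open>Expansion of the Pfaffian of \<open>C\<close>\<close>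

text \<open>Expanding the product of entries for each permutation gives a sum over choices
  \<open>\<phi>\<close> of column pairs, and the factorwise product separates the minors from the
  \<open>b\<close>. After exchanging the two sums, the inner one over permutations is
  \<open>D\<close> by \<open>D_eq_pairing_sum\<close>. This holds before the balancing relations are
  imposed.\<close>

lemma dyn_Pf_c_elt:
  fixes q :: complex and n :: nat
  assumes "CARD('n::{finite,linorder}) = 2 * n"
  shows "(dyn_Pf q (FB q) (fb_fun q) (c_elt q) :: 'n fb_elem) =
    finsum (FB q) (\<lambda>\<phi>. fb_tensor q (FR.D q (column_word \<phi>))
        (Balg.P.oprod (\<lambda>k. b_elt (nth_UNIV (fst (\<phi> k))) (nth_UNIV (snd (\<phi> k)))) 0 n))
      ({..<n} \<rightarrow>\<^sub>E pairs (2 * n))"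
proof -
  let ?e = "nth_UNIV :: nat \<Rightarrow> 'n"
  let ?E = "{..<n} \<rightarrow>\<^sub>E pairs (2 * n)"
  let ?b = "\<lambda>\<phi>. Balg.P.oprod (\<lambda>k. b_elt (?e (fst (\<phi> k))) (?e (snd (\<phi> k)))) 0 n"
  let ?W = "\<lambda>\<sigma> \<phi>. FR.P.oprod q (\<lambda>k. FR.minor2 q (\<sigma> (2 * k)) (\<sigma> (2 * k + 1)) (fst (\<phi> k)) (snd (\<phi> k))) 0 n"
  have finE: "finite ?E" by (intro finite_PiE) auto
  have bk: "b_elt (?e (fst p)) (?e (snd p)) \<in> carrier Balg" if "p \<in> pairs (2 * n)" for p
    using that by (intro b_elt_pair_closed) (simp add: assms)
  have b: "?b \<phi> \<in> carrier Balg" if "\<phi> \<in> ?E" for \<phi>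
    using that by (intro Balg.P.oprod_closed bk) (auto dest: PiE_mem)
  have W: "?W \<sigma> \<phi> \<in> carrier (FR q)" for \<sigma> \<phi>
    by (intro FR.P.oprod_closed FR.minor2_closed)
  have Wb: "fb_tensor q (?W \<sigma> \<phi>) (?b \<phi>) \<in> carrier (FB q)"
    and mWb: "fb_tensor q (mu_l q f \<otimes>\<^bsub>FR q\<^esub> ?W \<sigma> \<phi>) (?b \<phi>) \<in> carrier (FB q)" if "\<phi> \<in> ?E" for f \<sigma> \<phi>
    by (intro FB.tensor_closed FR.P.m_closed mu_l_closed W b that)+
  have prod: "ordered_prod (FB q) (map (\<lambda>k. c_elt q (?e (\<sigma> (2 * k))) (?e (\<sigma> (2 * k + 1)))) [0..<n]) =
      finsum (FB q) (\<lambda>\<phi>. fb_tensor q (?W \<sigma> \<phi>) (?b \<phi>)) ?E" if \<sigma>: "\<sigma> \<in> pairing_perms n" for \<sigma>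
  proof -
    have "\<sigma> (2 * k) < \<sigma> (2 * k + 1) \<and> \<sigma> (2 * k + 1) < 2 * n" if "k < n" for k
      using \<sigma> that permutes_in_image[of \<sigma> "{..<2 * n}" "2 * k + 1"] by (auto simp: pairing_perms_def)
    then have "ordered_prod (FB q) (map (\<lambda>k. c_elt q (?e (\<sigma> (2 * k))) (?e (\<sigma> (2 * k + 1)))) [0..<n]) =
        FB.T.P.oprod q (\<lambda>k. finsum (FB q) (\<lambda>p. fb_tensor q (FR.minor2 q (\<sigma> (2 * k)) (\<sigma> (2 * k + 1)) (fst p) (snd p))
          (b_elt (?e (fst p)) (?e (snd p)))) (pairs (2 * n))) 0 n"
      unfolding FB.T.P.oprod_def
      by (intro arg_cong[of _ _ "ordered_prod (FB q)"] map_cong refl)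
         (simp add: c_elt_eq assms case_prod_unfold)
    also have "\<dots> = finsum (FB q) (\<lambda>\<phi>. FB.T.P.oprod q (\<lambda>k. fb_tensor q
        (FR.minor2 q (\<sigma> (2 * k)) (\<sigma> (2 * k + 1)) (fst (\<phi> k)) (snd (\<phi> k)))
        (b_elt (?e (fst (\<phi> k))) (?e (snd (\<phi> k))))) 0 n) ?E"
      by (intro FB.T.P.oprod_finsum finite_pairs FB.tensor_closed bk FR.minor2_closed)
    also have "\<dots> = finsum (FB q) (\<lambda>\<phi>. fb_tensor q (?W \<sigma> \<phi>) (?b \<phi>)) ?E"
    proof (rule FB.T.P.finsum_cong'[OF refl])
      fix \<phi> assume "\<phi> \<in> ?E"
      then show "FB.T.P.oprod q (\<lambda>k. fb_tensor q
          (FR.minor2 q (\<sigma> (2 * k)) (\<sigma> (2 * k + 1)) (fst (\<phi> k)) (snd (\<phi> k)))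
          (b_elt (?e (fst (\<phi> k))) (?e (snd (\<phi> k))))) 0 n = fb_tensor q (?W \<sigma> \<phi>) (?b \<phi>)"
        by (intro FB.tensor_oprod bk FR.minor2_closed) (erule PiE_mem, simp)
    qed (intro Pi_I Wb)
    finally show ?thesis .
  qed
  have fun_mult: "fb_fun q f \<otimes>\<^bsub>FB q\<^esub> finsum (FB q) (\<lambda>\<phi>. fb_tensor q (?W \<sigma> \<phi>) (?b \<phi>)) ?E =
      finsum (FB q) (\<lambda>\<phi>. fb_tensor q (mu_l q f \<otimes>\<^bsub>FR q\<^esub> ?W \<sigma> \<phi>) (?b \<phi>)) ?E" for f \<sigma>
  proof -
    have "fb_fun q f \<otimes>\<^bsub>FB q\<^esub> finsum (FB q) (\<lambda>\<phi>. fb_tensor q (?W \<sigma> \<phi>) (?b \<phi>)) ?E =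
      finsum (FB q) (\<lambda>\<phi>. fb_fun q f \<otimes>\<^bsub>FB q\<^esub> fb_tensor q (?W \<sigma> \<phi>) (?b \<phi>)) ?E"
      by (rule FB.T.P.finsum_rdistr[OF finE]) (use Wb in \<open>simp_all add: Pi_def\<close>)
    also have "\<dots> = finsum (FB q) (\<lambda>\<phi>. fb_tensor q (mu_l q f \<otimes>\<^bsub>FR q\<^esub> ?W \<sigma> \<phi>) (?b \<phi>)) ?E"
    proof (rule FB.T.P.finsum_cong'[OF refl])
      fix \<phi> assume "\<phi> \<in> ?E"
      then show "fb_fun q f \<otimes>\<^bsub>FB q\<^esub> fb_tensor q (?W \<sigma> \<phi>) (?b \<phi>) = fb_tensor q (mu_l q f \<otimes>\<^bsub>FR q\<^esub> ?W \<sigma> \<phi>) (?b \<phi>)"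
        unfolding fb_fun_def
        by (subst FB.tensor_mult) (simp_all add: W b)
    qed (intro Pi_I mWb)
    finally show ?thesis .
  qed
  \<comment> \<open>For fixed \<open>\<phi>\<close> the second tensor factor does not depend on the
    permutation, so the sum can be taken in the first factor.\<close>
  have inner: "finsum (FB q) (\<lambda>\<sigma>. fb_tensor q (mu_l q (dyn_S q \<sigma> (UNIV :: 'n set)) \<otimes>\<^bsub>FR q\<^esub> ?W \<sigma> \<phi>) (?b \<phi>)) (pairing_perms n)
     = fb_tensor q (FR.D q (column_word \<phi>)) (?b \<phi>)" if \<phi>: "\<phi> \<in> ?E" for \<phi>
  proof -
    have "FR.D q (column_word \<phi>) = finsum (FR q) (\<lambda>\<sigma>. mu_l q (dyn_S q \<sigma> (UNIV :: 'n set)) \<otimes>\<^bsub>FR q\<^esub> ?W \<sigma> \<phi>) (pairing_perms n)"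
      by (subst FR.D_eq_pairing_sum[of n]) (simp_all add: assms pairing_perms_def dyn_S_eq)
    then show ?thesis
      using FB.tensor_finsum_left[of "pairing_perms n" "\<lambda>\<sigma>. mu_l q (dyn_S q \<sigma> (UNIV :: 'n set)) \<otimes>\<^bsub>FR q\<^esub> ?W \<sigma> \<phi>" q "?b \<phi>"]
        W b[OF \<phi>] by simp
  qed
  have "(dyn_Pf q (FB q) (fb_fun q) (c_elt q) :: 'n fb_elem) =
      finsum (FB q) (\<lambda>\<sigma>. finsum (FB q) (\<lambda>\<phi>. fb_tensor q (mu_l q (dyn_S q \<sigma> (UNIV :: 'n set)) \<otimes>\<^bsub>FR q\<^esub> ?W \<sigma> \<phi>) (?b \<phi>)) ?E) (pairing_perms n)"
    unfolding dyn_Pf_def assms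
  proof (rule FB.T.P.finsum_cong')
    show "pairing_perms (2 * n div 2) = pairing_perms n" by simp
    fix \<sigma> assume "\<sigma> \<in> pairing_perms n"
    then show "fb_fun q (dyn_S q \<sigma> (UNIV :: 'n set)) \<otimes>\<^bsub>FB q\<^esub> ordered_prod (FB q)
        (map (\<lambda>k. c_elt q (?e (\<sigma> (2 * k))) (?e (\<sigma> (2 * k + 1)))) [0..<2 * n div 2]) =
      finsum (FB q) (\<lambda>\<phi>. fb_tensor q (mu_l q (dyn_S q \<sigma> (UNIV :: 'n set)) \<otimes>\<^bsub>FR q\<^esub> ?W \<sigma> \<phi>) (?b \<phi>)) ?E"
      using prod[of \<sigma>] fun_mult[of "dyn_S q \<sigma> (UNIV :: 'n set)" \<sigma>] by simp
  qed (intro Pi_I FB.T.P.finsum_closed mWb)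
  also have "\<dots> = finsum (FB q) (\<lambda>\<phi>. finsum (FB q) (\<lambda>\<sigma>. fb_tensor q (mu_l q (dyn_S q \<sigma> (UNIV :: 'n set)) \<otimes>\<^bsub>FR q\<^esub> ?W \<sigma> \<phi>) (?b \<phi>)) (pairing_perms n)) ?E"
    by (intro FB.T.P.finsum_swap finE finite_pairing_perms mWb)
  also have "\<dots> = finsum (FB q) (\<lambda>\<phi>. fb_tensor q (FR.D q (column_word \<phi>)) (?b \<phi>)) ?E"
    by (rule FB.T.P.finsum_cong'[OF refl]) (use inner b in \<open>simp_all add: Pi_def\<close>)
  finally show ?thesis .
qed

theorem theorem4p2:
  fixes q :: complex and n :: nat
  assumes "q \<noteq> 0" and "\<And>m::nat. m > 0 \<Longrightarrow> q ^ m \<noteq> 1"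
    and "CARD('n::{finite,linorder}) = 2 * n"
  shows "dyn_class q (dyn_Pf q (FB q) (fb_fun q) (c_elt q) :: 'n fb_elem) =
         dyn_class q (fb_tensor q (dyn_det q) (dyn_Pf q Balg b_fun b_elt))"
proof -
  note N = assms(3)
  let ?e = "nth_UNIV :: nat \<Rightarrow> 'n"
  let ?E = "{..<n} \<rightarrow>\<^sub>E pairs (2 * n)"
  let ?b = "\<lambda>\<phi>. Balg.P.oprod (\<lambda>k. b_elt (?e (fst (\<phi> k))) (?e (snd (\<phi> k)))) 0 n"
  let ?F = "\<lambda>\<phi>. fb_tensor q (FR.D q (column_word \<phi>)) (?b \<phi>)"
  let ?y = "\<lambda>\<rho>. Balg.P.oprod (\<lambda>k. b_elt (?e (\<rho> (2 * k))) (?e (\<rho> (2 * k + 1)))) 0 n"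
  let ?D = "FR.D q id :: 'n fr_elem"
  have finE: "finite ?E" by (intro finite_PiE) auto
  have b: "?b \<phi> \<in> carrier Balg" if "\<phi> \<in> ?E" for \<phi>
    using that by (intro Balg.P.oprod_closed b_elt_pair_closed) (auto simp: N dest: PiE_mem)
  have Fc: "?F \<phi> \<in> carrier (FB q)" if "\<phi> \<in> ?E" for \<phi>
    using b[OF that] by simp
  have choice: "pair_choice n \<rho> \<in> ?E" if "\<rho> \<in> pairing_perms n" for \<rho>
    using bij_betwE[OF pairing_perms_bij] that by blast
  have choice_b: "?b (pair_choice n \<rho>) = ?y \<rho>" for \<rho>
    by (rule Balg.P.oprod_cong) (simp add: pair_choice_def)
  have y: "?y \<rho> \<in> carrier Balg" if "\<rho> \<in> pairing_perms n" for \<rho>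
    using b[OF choice[OF that]] by (simp only: choice_b)
  \<comment> \<open>The column word of a pairing permutation is the permutation itself on the
    positions that \<open>D\<close> sees, and sorting it produces \<open>mu_r\<close> of its
    coefficient.\<close>
  have F: "?F (pair_choice n \<rho>) = fb_tensor q (mu_r q (dyn_S q \<rho> (UNIV :: 'n set)) \<otimes>\<^bsub>FR q\<^esub> ?D) (?y \<rho>)"
    if \<rho>: "\<rho> \<in> pairing_perms n" for \<rho>
  proof -
    have "FR.D q (column_word (pair_choice n \<rho>)) = (FR.D q \<rho> :: 'n fr_elem)"
      by (intro FR.D_cong column_word_pair_choice) (simp add: N)
    also have "\<dots> = mu_r q (dyn_S q \<rho> (UNIV :: 'n set)) \<otimes>\<^bsub>FR q\<^esub> ?D"
      unfolding dyn_S_eq using \<rho> by (intro FR.D_permutes) (simp add: N pairing_perms_def)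
    finally show ?thesis by (simp only: choice_b)
  qed
  have Pf: "(dyn_Pf q (FB q) (fb_fun q) (c_elt q) :: 'n fb_elem) =
      finsum (FB q) (\<lambda>\<rho>. fb_tensor q (mu_r q (dyn_S q \<rho> (UNIV :: 'n set)) \<otimes>\<^bsub>FR q\<^esub> ?D) (?y \<rho>)) (pairing_perms n)"
  proof -
    \<comment> \<open>Choices that repeat a column contribute zero by \<open>D_not_inj\<close>; the
      remaining ones are exactly those of the pairing permutations.\<close>
    let ?I = "{\<phi> \<in> ?E. inj_on (column_word \<phi>) {..<2 * n}}"
    have "(dyn_Pf q (FB q) (fb_fun q) (c_elt q) :: 'n fb_elem) = finsum (FB q) ?F ?E"
      by (rule dyn_Pf_c_elt[OF N])
    also have "\<dots> = finsum (FB q) ?F ?I"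
    proof (rule FB.T.P.add.finprod_mono_neutral_cong_right[OF finE])
      fix \<phi> assume \<phi>: "\<phi> \<in> ?E - ?I"
      then have "FR.D q (column_word \<phi>) = (\<zero>\<^bsub>FR q\<^esub> :: 'n fr_elem)"
        using column_word_less[of \<phi> n "2 * n"] by (intro FR.D_not_inj) (auto simp: N)
      then show "?F \<phi> = \<zero>\<^bsub>FB q\<^esub>" using \<phi> b by (simp add: FB.tensor_zero_left)
    qed (use Fc in auto)
    also have "?I = pair_choice n ` pairing_perms n"
      using pairing_perms_bij[of n] by (simp add: bij_betw_def)
    also have "finsum (FB q) ?F (pair_choice n ` pairing_perms n) = finsum (FB q) (\<lambda>\<rho>. ?F (pair_choice n \<rho>)) (pairing_perms n)"
      using pairing_perms_bij[of n] choice
      by (intro FB.T.P.finsum_reindex) (use Fc in \<open>auto simp: bij_betw_def\<close>)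
    also have "\<dots> = finsum (FB q) (\<lambda>\<rho>. fb_tensor q (mu_r q (dyn_S q \<rho> (UNIV :: 'n set)) \<otimes>\<^bsub>FR q\<^esub> ?D) (?y \<rho>)) (pairing_perms n)"
      by (rule FB.T.P.finsum_cong'[OF refl])
         (use F y in \<open>simp_all add: Pi_def\<close>)
    finally show ?thesis .
  qed
  have PfB: "fb_tensor q ?D (dyn_Pf q Balg b_fun b_elt) =
      finsum (FB q) (\<lambda>\<rho>. fb_tensor q ?D (b_fun (dyn_S q \<rho> (UNIV :: 'n set)) \<otimes>\<^bsub>Balg\<^esub> ?y \<rho>)) (pairing_perms n)"
  proof -
    have eq: "dyn_Pf q Balg b_fun b_elt = finsum Balg (\<lambda>\<rho>. b_fun (dyn_S q \<rho> (UNIV :: 'n set)) \<otimes>\<^bsub>Balg\<^esub> ?y \<rho>) (pairing_perms n)"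
      unfolding dyn_Pf_def N Balg.P.oprod_def nonzero_mult_div_cancel_left[OF zero_neq_numeral[symmetric]] ..
    show ?thesis
      unfolding eq by (rule FB.tensor_finsum_right) (simp_all add: y[simplified])
  qed
  have closed: "fb_tensor q (mu_r q f \<otimes>\<^bsub>FR q\<^esub> ?D) (?y \<rho>) \<in> carrier (FB q)"
    "fb_tensor q ?D (b_fun f \<otimes>\<^bsub>Balg\<^esub> ?y \<rho>) \<in> carrier (FB q)" if "\<rho> \<in> pairing_perms n" for f \<rho>
    using y[OF that] by simp_all
  show ?thesis
    unfolding dyn_det_eq Pf PfB
  proof (rule dyn_class_eqI)
    \<comment> \<open>The sums are compared term by term: the difference at \<open>\<rho>\<close> is
      the balancing element with function \<open>dyn_S q \<rho> UNIV\<close>, first factor the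
      determinant \<open>?D\<close> and second factor the monomial \<open>?y \<rho>\<close>.\<close>
    show "finsum (FB q) (\<lambda>\<rho>. fb_tensor q (mu_r q (dyn_S q \<rho> (UNIV :: 'n set)) \<otimes>\<^bsub>FR q\<^esub> ?D) (?y \<rho>)) (pairing_perms n) \<ominus>\<^bsub>FB q\<^esub>
      finsum (FB q) (\<lambda>\<rho>. fb_tensor q ?D (b_fun (dyn_S q \<rho> (UNIV :: 'n set)) \<otimes>\<^bsub>Balg\<^esub> ?y \<rho>)) (pairing_perms n) \<in> balancing q"
      using closed y
      by (intro FB.T.P.finsum_minus_mem balancing_additive_subgroup finite_pairing_perms balancing_mem FR.D_closed)
  qed (use closed in \<open>simp_all add: FB.T.P.finsum_closed Pi_def\<close>)
qed

end
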